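(* Let $d\ge 1$ and $n\ge 1$ be integers, and let $Q$ be a finite multigraph (multiple edges and loops allowed) with $n$ vertices and $m=\binom{d+1}{2}(n-1)+d^2$ edges. Then the following two conditions on $Q$ are equivalent: (i) the edge set of $Q$ decomposes into a disjoint union of the edge sets of two graphs on the full set of $n$ vertices, one having $dn-d$ edges and sparsity type $dn-d$, the other having $\binom{d}{2}n+\binom{d+1}{2}$ edges and sparsity type $\binom{d}{2}n+\binom{d+1}{2}$; (ii) $Q$ contains the (edge-)disjoint union of two graphs on the full set of $n$ vertices, one having $dn-d$ edges and sparsity type $dn-d$, the other having $\binom{d}{2}n$ edges and sparsity type $\binom{d}{2}n$. Moreover, $Q$ is (isomorphic to) the quotient graph $G/\Gamma$ of an infinitesimally rigid $d$-periodic body-and-bar framework in $\mathbb{R}^d$ if and only if it satisfies one, and hence both, of the conditions (i), (ii).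
   Context: Sparsity. For integers $a\ge 0$ and $b$, a multigraph (possibly with loops) on $n$ vertices has sparsity type $an+b$ (is $an+b$ sparse) if every nonempty subset of $n'$ vertices spans at most $an'+b$ edges (loops counted). Periodic graphs. A $d$-periodic body-and-bar graph is a pair $(G,\Gamma)$, where $G=(V,E)$ is an infinite multigraph (edges join distinct vertices) and $\Gamma\subset \mathrm{Aut}(G)$ is a free Abelian group of rank $d$ acting without fixed points with finitely many vertex orbits and edge orbits. Put $n=|V/\Gamma|$ and $m=|E/\Gamma|$; the quotient $G/\Gamma=(V/\Gamma,E/\Gamma)$ is a finite multigraph, possibly with loops. Frameworks. A presentation of $(G,\Gamma)$ in $\mathbb{R}^d$ consists of: an assignment $\tau:V\to SE(d)$, $\tau(i)=(p_i,M_i)$ with $p_i\in\mathbb{R}^d$, $M_i\in SO(d)$ (a Cartesian frame marking the rigid body $i$, acting by $x\mapsto M_ix+p_i$); an injective homomorphism $\pi$ from $\Gamma$ to the translations of $\mathbb{R}^d$ whose image is a lattice of rank $d$; and, for each edge $e=(i,j)$, attachment points $q^i(e),q^j(e)\in\mathbb{R}^d$ given in the coordinates of the bodies $i,j$, so that the bar $e$ has endpoints $M_iq^i+p_i$ and $M_jq^j+p_j$. The data are periodic: $\tau(\gamma i)=\pi(\gamma)\tau(i)$ and $q^{\gamma i}(\gamma e)=q^i(e)$ for $\gamma\in\Gamma$. A $d$-periodic body-and-bar framework is a connected $d$-periodic graph together with a presentation in which all bars have non-zero length. Infinitesimal rigidity. Choose a basis of $\Gamma$ (so $\Gamma\cong\mathbb{Z}^d$)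 and let $\Lambda$ be the $d\times d$ matrix whose columns are the corresponding translation vectors. Choose representatives $1,\dots,n$ of the vertex orbits and an orientation of $G/\Gamma$; represent each edge orbit by the edge $e$ originating at a chosen vertex representative $i$, so that its other end is the translate of a representative $j$ by the period $\Lambda c$, with $c=C(e)\in\mathbb{Z}^d$. Marking the bodies so that $p_i=0$, $M_i=I_d$ for all chosen representatives, the rigidity matrix is the matrix of the linear system, with one equation for each of the $m$ edge representatives, $$\langle \dot\Lambda c+A_jq^j-A_iq^i+\dot p_j-\dot p_i,\ \Lambda c+q^j-q^i\rangle=0$$ in the unknowns $\dot p_i\in\mathbb{R}^d$, $A_i\in\mathbb{R}^{d\times d}$ skew-symmetric ($i=1,\dots,n$) and $\dot\Lambda\in\mathbb{R}^{d\times d}$. The framework is infinitesimally rigid if this matrix has the maximal possible rank $\binom{d+1}{2}(n-1)+d^2$, equivalently if the solution space is exactly the $\binom{d+1}{2}$-dimensional space of trivial infinitesimal motions coming from isometries of $\mathbb{R}^d$. *)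

theory Defs
  imports
    "HOL-Analysis.Analysis"
    "HOL-Analysis.Finite_Function_Topology"
    "HOL-Algebra.Free_Abelian_Groups"
    "HOL-Algebra.Group_Action"
    "HOL-Library.Infinite_Typeclass"
begin

section \<open>Multigraphs and sparsity\<close>

text \<open>An edge carries its set of end-vertices: two vertices, or one vertex for a loop.\<close>

record ('v, 'e) multigraph =
  verts :: "'v set"
  edges :: "'e set"
  ends :: "'e \<Rightarrow> 'v set"

definition is_multigraph :: "('v, 'e) multigraph \<Rightarrow> bool" where
  "is_multigraph G \<longleftrightarrow>
     (\<forall>e \<in> edges G. ends G e \<subseteq> verts G \<and> (card (ends G e) = 1 \<or> card (ends G e) = 2))"

definition finite_multigraph :: "('v, 'e) multigraph \<Rightarrow> bool" where
  "finite_multigraph G \<longleftrightarrow> is_multigraph G \<and> finite (verts G) \<and> finite (edges G)"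

definition loopless :: "('v, 'e) multigraph \<Rightarrow> bool" where
  "loopless G \<longleftrightarrow> (\<forall>e \<in> edges G. card (ends G e) = 2)"

definition connected_multigraph :: "('v, 'e) multigraph \<Rightarrow> bool" where
  "connected_multigraph G \<longleftrightarrow>
     (\<forall>u \<in> verts G. \<forall>v \<in> verts G. (\<lambda>x y. \<exists>e \<in> edges G. ends G e = {x, y})\<^sup>*\<^sup>* u v)"

definition multigraph_iso :: "('v, 'e) multigraph \<Rightarrow> ('w, 'f) multigraph \<Rightarrow> bool" where
  "multigraph_iso G H \<longleftrightarrow>
     (\<exists>f g. bij_betw f (verts G) (verts H) \<and> bij_betw g (edges G) (edges H) \<and>
            (\<forall>e \<in> edges G. ends H (g e) = f ` ends G e))"

definition sparsity_type :: "nat \<Rightarrow> int \<Rightarrow> ('v, 'e) multigraph \<Rightarrow> bool" where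
  "sparsity_type a b G \<longleftrightarrow>
     (\<forall>S. S \<subseteq> verts G \<and> S \<noteq> {} \<longrightarrow>
        int (card {e \<in> edges G. ends G e \<subseteq> S}) \<le> int a * int (card S) + b)"

definition tight :: "nat \<Rightarrow> int \<Rightarrow> ('v, 'e) multigraph \<Rightarrow> bool" where
  "tight a b G \<longleftrightarrow> sparsity_type a b G \<and> int (card (edges G)) = int a * int (card (verts G)) + b"

definition spanning_subgraph :: "('v, 'e) multigraph \<Rightarrow> 'e set \<Rightarrow> ('v, 'e) multigraph" where
  "spanning_subgraph G F = G\<lparr>edges := F\<rparr>"

definition sparse_decomposition :: "nat \<Rightarrow> ('v, 'e) multigraph \<Rightarrow> bool" where
  "sparse_decomposition d Q \<longleftrightarrow>
     (\<exists>E1 E2. E1 \<inter> E2 = {} \<and> E1 \<union> E2 = edges Q \<and>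
        tight d (- int d) (spanning_subgraph Q E1) \<and>
        tight (d choose 2) (int ((d + 1) choose 2)) (spanning_subgraph Q E2))"

definition sparse_disjoint_subgraphs :: "nat \<Rightarrow> ('v, 'e) multigraph \<Rightarrow> bool" where
  "sparse_disjoint_subgraphs d Q \<longleftrightarrow>
     (\<exists>E1 E2. E1 \<inter> E2 = {} \<and> E1 \<union> E2 \<subseteq> edges Q \<and>
        tight d (- int d) (spanning_subgraph Q E1) \<and>
        tight (d choose 2) 0 (spanning_subgraph Q E2))"


section \<open>Periodic graphs and their quotients\<close>

text \<open>An automorphism is a pair of a vertex permutation and a compatible edge permutation.\<close>

type_synonym ('v, 'e) graph_perm = "('v \<Rightarrow> 'v) \<times> ('e \<Rightarrow> 'e)"

definition graph_aut :: "('v, 'e) multigraph \<Rightarrow> ('v, 'e) graph_perm monoid" where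
  "graph_aut G = (BijGroup (verts G) \<times>\<times> BijGroup (edges G))
     \<lparr>carrier := {(f, g). f \<in> Bij (verts G) \<and> g \<in> Bij (edges G) \<and>
                          (\<forall>e \<in> edges G. ends G (g e) = f ` ends G e)}\<rparr>"

abbreviation aut_subgroup ::
  "('v, 'e) multigraph \<Rightarrow> ('v, 'e) graph_perm set \<Rightarrow> ('v, 'e) graph_perm monoid" where
  "aut_subgroup G \<Gamma> \<equiv> (graph_aut G)\<lparr>carrier := \<Gamma>\<rparr>"

text \<open>The orbit of an edge has well-defined ends, since automorphisms preserve incidence;
  the union below is over identical sets.\<close>

definition quotient_graph ::
  "('v, 'e) multigraph \<Rightarrow> ('v, 'e) graph_perm set \<Rightarrow> ('v set, 'e set) multigraph" where
  "quotient_graph G \<Gamma> =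
     \<lparr>verts = orbits (aut_subgroup G \<Gamma>) (verts G) fst,
      edges = orbits (aut_subgroup G \<Gamma>) (edges G) snd,
      ends = (\<lambda>X. \<Union>e \<in> X. orbit (aut_subgroup G \<Gamma>) fst ` ends G e)\<rparr>"

text \<open>Fixed-point freeness is stated on vertices. It implies freeness on edges: if \<open>\<gamma>\<close> fixes an
  edge, then \<open>\<gamma>\<^sup>2\<close> fixes its ends, so \<open>\<gamma>\<^sup>2 = 1\<close>, and \<open>\<gamma> = 1\<close> because the group is torsion-free.\<close>

definition periodic_graph ::
  "nat \<Rightarrow> ('v, 'e) multigraph \<Rightarrow> ('v, 'e) graph_perm set \<Rightarrow> bool" where
  "periodic_graph d G \<Gamma> \<longleftrightarrow>
     is_multigraph G \<and> loopless G \<and> infinite (verts G) \<and>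
     subgroup \<Gamma> (graph_aut G) \<and>
     aut_subgroup G \<Gamma> \<cong> free_Abelian_group {..<d} \<and>
     (\<forall>\<gamma> \<in> \<Gamma>. \<gamma> \<noteq> \<one>\<^bsub>graph_aut G\<^esub> \<longrightarrow> (\<forall>v \<in> verts G. fst \<gamma> v \<noteq> v)) \<and>
     finite (verts (quotient_graph G \<Gamma>)) \<and> finite (edges (quotient_graph G \<Gamma>))"


section \<open>Periodic body-and-bar frameworks\<close>

text \<open>The body \<open>v\<close> carries the frame \<open>x \<mapsto> rot v *v x + pos v\<close>; translations are identified with
  their vectors; \<open>attach v e\<close> is the attachment point of the bar \<open>e\<close> on the body \<open>v\<close>, in the
  coordinates of \<open>v\<close>, and is meaningful only if \<open>v\<close> is an end of \<open>e\<close>.\<close>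

record ('v, 'e, 'd) framework =
  graph :: "('v, 'e) multigraph"
  periods :: "('v, 'e) graph_perm set"
  pos :: "'v \<Rightarrow> real ^ 'd"
  rot :: "'v \<Rightarrow> real ^ 'd ^ 'd"
  translation :: "('v, 'e) graph_perm \<Rightarrow> real ^ 'd"
  attach :: "'v \<Rightarrow> 'e \<Rightarrow> real ^ 'd"

definition int_vec :: "('d \<Rightarrow> int) \<Rightarrow> real ^ 'd" where
  "int_vec c = (\<chi> k. of_int (c k))"

definition full_lattice :: "(real ^ 'd) set \<Rightarrow> bool" where
  "full_lattice L \<longleftrightarrow> (\<exists>B :: real ^ 'd ^ 'd. invertible B \<and> L = range (\<lambda>c. B *v int_vec c))"

definition bar_end :: "('v, 'e, 'd::finite) framework \<Rightarrow> 'v \<Rightarrow> 'e \<Rightarrow> real ^ 'd" where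
  "bar_end F v e = rot F v *v attach F v e + pos F v"

definition presentation :: "('v, 'e, 'd::finite) framework \<Rightarrow> bool" where
  "presentation F \<longleftrightarrow>
     (\<forall>v \<in> verts (graph F). rotation_matrix (rot F v)) \<and>
     (\<forall>\<gamma> \<in> periods F. \<forall>\<delta> \<in> periods F.
        translation F (\<gamma> \<otimes>\<^bsub>graph_aut (graph F)\<^esub> \<delta>) = translation F \<gamma> + translation F \<delta>) \<and>
     inj_on (translation F) (periods F) \<and>
     full_lattice (translation F ` periods F) \<and>
     (\<forall>\<gamma> \<in> periods F. \<forall>v \<in> verts (graph F).
        pos F (fst \<gamma> v) = pos F v + translation F \<gamma> \<and> rot F (fst \<gamma> v) = rot F v) \<and>
     (\<forall>\<gamma> \<in> periods F. \<forall>e \<in> edges (graph F). \<forall>v \<in> ends (graph F) e.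
        attach F (fst \<gamma> v) (snd \<gamma> e) = attach F v e)"

definition periodic_framework :: "('v, 'e, 'd::finite) framework \<Rightarrow> bool" where
  "periodic_framework F \<longleftrightarrow>
     periodic_graph CARD('d) (graph F) (periods F) \<and>
     connected_multigraph (graph F) \<and>
     presentation F \<and>
     (\<forall>e \<in> edges (graph F). \<forall>u v. ends (graph F) e = {u, v} \<and> u \<noteq> v \<longrightarrow>
        bar_end F u e \<noteq> bar_end F v e)"


section \<open>Infinitesimal rigidity\<close>

text \<open>The choices entering the rigidity matrix: a basis of the period group, given as an
  isomorphism from the free Abelian group on \<open>'d\<close>; representatives of the vertex and edge orbits;
  and for each edge representative \<open>e\<close> its origin \<open>src e\<close>, the vertex representative \<open>tgt e\<close>
  of its other end, and the coordinates \<open>gain e\<close> of the period carrying \<open>tgt e\<close> to that end.\<close>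

record ('v, 'e, 'd) representatives =
  basis_iso :: "('d \<Rightarrow>\<^sub>0 int) \<Rightarrow> ('v, 'e) graph_perm"
  vreps :: "'v set"
  ereps :: "'e set"
  src :: "'e \<Rightarrow> 'v"
  tgt :: "'e \<Rightarrow> 'v"
  gain :: "'e \<Rightarrow> ('d \<Rightarrow>\<^sub>0 int)"

definition far_end :: "('v, 'e, 'd::finite) representatives \<Rightarrow> 'e \<Rightarrow> 'v" where
  "far_end R e = fst (basis_iso R (gain R e)) (tgt R e)"

definition valid_representatives ::
  "('v, 'e, 'd::finite) framework \<Rightarrow> ('v, 'e, 'd) representatives \<Rightarrow> bool" where
  "valid_representatives F R \<longleftrightarrow>
     basis_iso R \<in> iso (free_Abelian_group UNIV) (aut_subgroup (graph F) (periods F)) \<and>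
     vreps R \<subseteq> verts (graph F) \<and>
     (\<forall>X \<in> verts (quotient_graph (graph F) (periods F)). \<exists>!v. v \<in> vreps R \<and> v \<in> X) \<and>
     ereps R \<subseteq> edges (graph F) \<and>
     (\<forall>X \<in> edges (quotient_graph (graph F) (periods F)). \<exists>!e. e \<in> ereps R \<and> e \<in> X) \<and>
     (\<forall>e \<in> ereps R. src R e \<in> vreps R \<and> tgt R e \<in> vreps R \<and>
        ends (graph F) e = {src R e, far_end R e})"

definition period_matrix ::
  "('v, 'e, 'd::finite) framework \<Rightarrow> ('v, 'e, 'd) representatives \<Rightarrow> real ^ 'd ^ 'd" where
  "period_matrix F R = (\<chi> r k. translation F (basis_iso R (frag_of k)) $ r)"

definition gain_vec :: "('v, 'e, 'd::finite) representatives \<Rightarrow> 'e \<Rightarrow> real ^ 'd" where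
  "gain_vec R e = int_vec (Poly_Mapping.lookup (gain R e))"

text \<open>Re-marking the bodies so that every vertex representative has frame \<open>(0, I)\<close> (hence the
  translate of a representative by \<open>\<gamma>\<close> has frame \<open>(translation F \<gamma>, I)\<close>) moves the bars nowhere,
  and turns the two attachment points of an edge representative into the following.\<close>

definition src_attach ::
  "('v, 'e, 'd::finite) framework \<Rightarrow> ('v, 'e, 'd) representatives \<Rightarrow> 'e \<Rightarrow> real ^ 'd" where
  "src_attach F R e = bar_end F (src R e) e"

definition tgt_attach ::
  "('v, 'e, 'd::finite) framework \<Rightarrow> ('v, 'e, 'd) representatives \<Rightarrow> 'e \<Rightarrow> real ^ 'd" where
  "tgt_attach F R e = bar_end F (far_end R e) e - translation F (basis_iso R (gain R e))"

text \<open>The left-hand side of the equation of the bar \<open>e\<close>, in the unknowns \<open>p\<close>, \<open>A\<close> and \<open>L\<close>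
  (the derivatives of positions, frames and \<open>period_matrix\<close>).\<close>

definition bar_equation ::
  "('v, 'e, 'd::finite) framework \<Rightarrow> ('v, 'e, 'd) representatives \<Rightarrow>
   ('v \<Rightarrow> real ^ 'd) \<Rightarrow> ('v \<Rightarrow> real ^ 'd ^ 'd) \<Rightarrow> real ^ 'd ^ 'd \<Rightarrow> 'e \<Rightarrow> real" where
  "bar_equation F R p A L e =
     (L *v gain_vec R e
        + A (tgt R e) *v tgt_attach F R e - A (src R e) *v src_attach F R e
        + p (tgt R e) - p (src R e))
     \<bullet> (period_matrix F R *v gain_vec R e + tgt_attach F R e - src_attach F R e)"

text \<open>The rank of the rigidity matrix is the dimension of its column space, that is, of the set of
  all its values, indexed by the edge representatives. Only the values of \<open>p\<close> and \<open>A\<close> at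
  the vertex representatives enter, so these are the actual unknowns.\<close>

definition rigidity_rank ::
  "('v, 'e, 'd::finite) framework \<Rightarrow> ('v, 'e, 'd) representatives \<Rightarrow> nat" where
  "rigidity_rank F R =
     dim {(\<Sum>e \<in> ereps R. Poly_Mapping.single e (bar_equation F R p A L e)) | p A L.
            \<forall>v \<in> vreps R. transpose (A v) = - A v}"

text \<open>The rank does not depend on the representatives chosen, and some always exist.\<close>

definition infinitesimally_rigid :: "('v, 'e, 'd::finite) framework \<Rightarrow> bool" where
  "infinitesimally_rigid F \<longleftrightarrow>
     (\<exists>R. valid_representatives F R \<and>
        rigidity_rank F R =
          ((CARD('d) + 1) choose 2) * (card (verts (quotient_graph (graph F) (periods F))) - 1)
            + CARD('d)\<^sup>2)"

end

theory Submission
  imports Defs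
begin

text \<open>
  Necessity: the rigidity matrix of a rigid framework has independent rows. Each row is the sum of
  a part in the position unknowns and a part in the frame and lattice unknowns. Replacing one row
  after another by one of its two parts, independence can be kept, and this splits the edges into
  two classes. On a vertex set \<open>S\<close>, the first parts live in a space of dimension \<open>d(|S| - 1)\<close>; the
  second parts are invariant under rotations of the whole framework and live in a space of dimension
  \<open>(d choose 2)(|S| - 1) + d\<^sup>2 = (d choose 2)|S| + (d + 1 choose 2)\<close>. These are the sparsity bounds.

  Sufficiency: no generic choice of attachment points is needed. The edges of the first graph get
  gain \<open>0\<close> and directions that force all position velocities to agree. By Hall's theorem the edges
  of the second graph are matched with the pairs (vertex, skew-symmetric matrix entry) and with
  \<open>(d + 1 choose 2)\<close> further symbols, the upper triangular entries of the lattice velocity \<open>L\<close>. With unit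
  vectors as gains and bars, each of these edges controls exactly the unknown it is matched with, so
  the system is triangular.
\<close>

text \<open>The number \<open>m\<close> of edges is the maximal rank. Infinitesimal rigidity
  therefore means that the rows are independent, and equally that the bar equations are solvable for
  all right-hand sides. Necessity uses the first form, sufficiency the second. The constant
  \<open>(d + 1) choose 2\<close> is what rotations of the whole framework leave of the
  \<open>d\<^sup>2\<close> entries of the lattice velocity: \<open>d\<^sup>2 - (d choose 2)\<close>.
  This is also the number of entries on and above the diagonal, so in the construction
  \<open>L\<close> can be taken upper triangular. Realisation asks for more than rank. The periodic
  graph must be connected and loopless and all bars must have non-zero length. Connectedness comes
  from the first graph, which links the vertices with gain 0, and from the diagonal symbols, whose
  edges carry the basis vectors as gains. Loops are harmless because they all lie in the second
  graph, where every gain is non-zero.\<close>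

section \<open>Sparse multigraphs\<close>

text \<open>The proof is Rado's: a minimal family satisfying Hall's condition consists of singletons,
  because of two points of \<open>A i\<close> at least one can be deleted.\<close>

lemma Hall_marriage:
  assumes "finite I" and "\<And>i. i \<in> I \<Longrightarrow> finite (A i)"
    and "\<And>J. J \<subseteq> I \<Longrightarrow> card J \<le> card (\<Union>i\<in>J. A i)"
  shows "\<exists>f. inj_on f I \<and> (\<forall>i\<in>I. f i \<in> A i)"
  using assms
proof (induction "\<Sum>i\<in>I. card (A i)" arbitrary: A rule: less_induct)
  case less
  show ?case
  proof (cases "\<exists>i\<in>I. \<exists>x\<in>A i. \<exists>y\<in>A i. x \<noteq> y")
    case False
    have ne: "A i \<noteq> {}" if "i \<in> I" for i
      using less.prems(3)[of "{i}"] that by auto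
    define f where "f i = (SOME x. x \<in> A i)" for i
    have f: "f i \<in> A i" if "i \<in> I" for i
      using ne[OF that] unfolding f_def by (rule some_in_eq[THEN iffD2])
    have "inj_on f I"
    proof (rule inj_onI, rule ccontr)
      fix i j assume ij: "i \<in> I" "j \<in> I" "f i = f j" "i \<noteq> j"
      have "(\<Union>k\<in>{i,j}. A k) = {f i}"
        using f[OF ij(1)] f[OF ij(2)] ij False by auto
      then show False
        using less.prems(3)[of "{i,j}"] ij by simp
    qed
    then show ?thesis using f by blast
  next
    case True
    then obtain i x y where i: "i \<in> I" and x: "x \<in> A i" and y: "y \<in> A i" and xy: "x \<noteq> y" by blast
    define B where "B z = A(i := A i - {z})" for z
    have fin: "finite (B z j)" if "j \<in> I" for z j
      using less.prems(2)[OF that] by (auto simp: B_def)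
    have small: "(\<Sum>j\<in>I. card (B z j)) < (\<Sum>j\<in>I. card (A j))" if "z \<in> A i" for z
    proof (rule sum_strict_mono_ex1)
      show "\<forall>j\<in>I. card (B z j) \<le> card (A j)"
        using less.prems(2) by (auto simp: B_def intro: card_mono)
      show "\<exists>j\<in>I. card (B z j) < card (A j)"
        using i card_Diff1_less[OF less.prems(2)[OF i] that] by (intro bexI[of _ i]) (simp_all add: B_def)
    qed (use less.prems(1) in auto)
    \<comment> \<open>A violating \<open>J\<close> must contain \<open>i\<close>, since only
      \<open>A i\<close> has shrunk. Removing \<open>i\<close> from \<open>J\<close> lowers its size
      by one, which turns the strict inequality into a weak one for \<open>K\<close>.\<close>
    have bad: "\<exists>K. K \<subseteq> I - {i} \<and> card ((\<Union>j\<in>K. A j) \<union> (A i - {z})) \<le> card K"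
      if viol: "\<not> (\<forall>J. J \<subseteq> I \<longrightarrow> card J \<le> card (\<Union>j\<in>J. B z j))" for z
    proof -
      obtain J where J: "J \<subseteq> I" "card J > card (\<Union>j\<in>J. B z j)"
        using viol by (meson not_less)
      have iJ: "i \<in> J"
      proof (rule ccontr)
        assume "i \<notin> J"
        then have "(\<Union>j\<in>J. B z j) = (\<Union>j\<in>J. A j)" by (auto simp: B_def)
        then show False using less.prems(3)[OF J(1)] J(2) by simp
      qed
      have "(\<Union>j\<in>J. B z j) = (\<Union>j\<in>J-{i}. A j) \<union> (A i - {z})"
        using iJ by (auto simp: B_def split: if_splits)
      moreover have "card J = Suc (card (J - {i}))"
        using iJ J(1) less.prems(1) by (metis card.remove finite_subset)
      ultimately show ?thesis using J by (intro exI[of _ "J - {i}"]) auto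
    qed
    \<comment> \<open>If both deletions failed, with witnesses \<open>K\<close> and
      \<open>L\<close>, then the union of the two reduced neighbourhoods would contain all of
      \<open>A i\<close>, because x and y differ, and their intersection would contain the
      neighbourhood of \<open>K \<inter> L\<close>. Hall's condition for
      \<open>insert i (K \<union> L)\<close> and for \<open>K \<inter> L\<close> then exceeds
      \<open>card K + card L\<close> by one.\<close>
    have "\<exists>z\<in>{x,y}. \<forall>J. J \<subseteq> I \<longrightarrow> card J \<le> card (\<Union>j\<in>J. B z j)"
    proof (rule ccontr)
      assume neg: "\<not> ?thesis"
      obtain K where K: "K \<subseteq> I - {i}" "card ((\<Union>j\<in>K. A j) \<union> (A i - {x})) \<le> card K"
        using bad[of x] neg by auto
      obtain L where L: "L \<subseteq> I - {i}" "card ((\<Union>j\<in>L. A j) \<union> (A i - {y})) \<le> card L"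
        using bad[of y] neg by auto
      let ?P = "(\<Union>j\<in>K. A j) \<union> (A i - {x})" and ?R = "(\<Union>j\<in>L. A j) \<union> (A i - {y})"
      have finKL: "finite K" "finite L" using K L less.prems(1) by (auto intro: finite_subset)
      have finPR: "finite ?P" "finite ?R"
        using less.prems(2) K(1) L(1) finKL i by (simp_all add: subset_iff)
      have "card (insert i (K \<union> L)) \<le> card (\<Union>j\<in>insert i (K \<union> L). A j)"
        using K L i by (intro less.prems(3)) auto
      also have "\<dots> \<le> card (?P \<union> ?R)"
        using finPR xy by (intro card_mono) auto
      finally have 1: "Suc (card (K \<union> L)) \<le> card (?P \<union> ?R)"
        using K L finKL by (subst (asm) card_insert_disjoint) auto
      have "card (K \<inter> L) \<le> card (\<Union>j\<in>K \<inter> L. A j)"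
        using K L by (intro less.prems(3)) auto
      also have "\<dots> \<le> card (?P \<inter> ?R)"
        using finPR by (intro card_mono) auto
      finally show False
        using 1 K(2) L(2) card_Un_Int[OF finPR] card_Un_Int[OF finKL] by linarith
    qed
    then obtain z where z: "z \<in> A i" "\<And>J. J \<subseteq> I \<Longrightarrow> card J \<le> card (\<Union>j\<in>J. B z j)"
      using x y by blast
    obtain f where f: "inj_on f I" "\<forall>j\<in>I. f j \<in> B z j"
      using less.hyps[OF small[OF z(1)] less.prems(1) fin z(2)] by blast
    moreover have "B z j \<subseteq> A j" for j by (auto simp: B_def)
    ultimately show ?thesis by blast
  qed
qed

text \<open>Sparsity is Hall's condition for edges choosing slots: every vertex offers
  \<open>a\<close> slots to its incident edges, and \<open>b\<close> further slots are open to all.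
  A set of edges with vertex support \<open>S\<close> sees \<open>a |S| + b\<close> slots. Tightness
  says that there are as many edges as slots, so the matching is onto.\<close>

lemma tight_assignment:
  assumes Q: "finite_multigraph Q" and E: "E \<subseteq> edges Q"
    and tight: "tight a (int b) (spanning_subgraph Q E)"
    and P: "finite P" "card P = a" and W: "finite W" "card W = b"
  shows "\<exists>f. bij_betw f E ((verts Q \<times> P) <+> W) \<and> (\<forall>e\<in>E. \<forall>j p. f e = Inl (j, p) \<longrightarrow> j \<in> ends Q e)"
proof -
  have finV: "finite (verts Q)" and finE: "finite E"
    and ends: "\<And>e. e \<in> E \<Longrightarrow> ends Q e \<subseteq> verts Q"
    and card: "\<And>e. e \<in> E \<Longrightarrow> card (ends Q e) = 1 \<or> card (ends Q e) = 2"
    using Q E finite_subset[OF E] unfolding finite_multigraph_def is_multigraph_def by blast+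
  have ne: "ends Q e \<noteq> {}" if "e \<in> E" for e
    using card[OF that] by force
  let ?A = "\<lambda>e. (ends Q e \<times> P) <+> W"
  have "\<exists>f. inj_on f E \<and> (\<forall>e\<in>E. f e \<in> ?A e)"
  proof (rule Hall_marriage[OF finE])
    show "finite (?A e)" if "e \<in> E" for e
      using finite_subset[OF ends[OF that] finV] P W by simp
    fix J assume J: "J \<subseteq> E"
    show "card J \<le> card (\<Union>e\<in>J. ?A e)"
    proof (cases "J = {}")
      case False
      let ?S = "\<Union>e\<in>J. ends Q e"
      have S: "?S \<subseteq> verts Q" using J ends by blast
      have "?S \<noteq> {}" using False J ne by blast
      then have "int (card {e \<in> E. ends Q e \<subseteq> ?S}) \<le> int a * int (card ?S) + int b"
        using tight S by (simp add: tight_def sparsity_type_def spanning_subgraph_def)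
      moreover have "card J \<le> card {e \<in> E. ends Q e \<subseteq> ?S}"
        using J finE by (intro card_mono) auto
      moreover have "(\<Union>e\<in>J. ?A e) = (?S \<times> P) <+> W" using False by auto
      moreover have "card ((?S \<times> P) <+> W) = card ?S * a + b"
        using finite_subset[OF S finV] P W by (simp add: card_Plus card_cartesian_product)
      ultimately show ?thesis by (simp add: mult.commute flip: of_nat_mult of_nat_add)
    qed simp
  qed
  then obtain f where f: "inj_on f E" "\<And>e. e \<in> E \<Longrightarrow> f e \<in> ?A e" by blast
  have "f ` E = (verts Q \<times> P) <+> W"
  proof (rule card_subset_eq)
    show "finite ((verts Q \<times> P) <+> W)" using finV P W by simp
    show "f ` E \<subseteq> (verts Q \<times> P) <+> W"
    proof
      fix y assume "y \<in> f ` E"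
      then obtain e where e: "e \<in> E" "y = f e" by blast
      show "y \<in> (verts Q \<times> P) <+> W"
        using f(2)[OF e(1)] ends[OF e(1)] e(2) by auto
    qed
    have "int (card E) = int a * int (card (verts Q)) + int b"
      using tight by (simp add: tight_def spanning_subgraph_def)
    then show "card (f ` E) = card ((verts Q \<times> P) <+> W)"
      using finV P W f(1) by (simp add: card_image card_Plus card_cartesian_product mult.commute flip: of_nat_mult of_nat_add)
  qed
  then have "bij_betw f E ((verts Q \<times> P) <+> W)" using f(1) by (simp add: bij_betw_def)
  moreover have "j \<in> ends Q e" if "e \<in> E" "f e = Inl (j, p)" for e j p
    using f(2)[OF that(1)] that(2) by auto
  ultimately show ?thesis by blast
qed

section \<open>Equivalence of the two sparsity conditions\<close>

lemma choose_two_identities: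
  "(d + 1) choose 2 = (d choose 2) + d" "d + 2 * (d choose 2) = d\<^sup>2"
proof -
  show "(d + 1) choose 2 = (d choose 2) + d" by (simp add: numeral_2_eq_2)
  have "2 * (d choose 2) + d = d * d" by (induction d) (auto simp: numeral_2_eq_2)
  then show "d + 2 * (d choose 2) = d\<^sup>2" by (simp add: power2_eq_square)
qed

text \<open>From (i) to (ii), the edges matched with a free slot are discarded; every remaining edge
  owns a slot at one of its ends, and this matching certifies the sharper bound. From (ii) to (i),
  the edge count leaves exactly \<open>(d + 1) choose 2\<close> edges outside both graphs, and
  adding them raises every span by at most that number.\<close>

lemma sparse_decomposition_iff:
  assumes Q: "finite_multigraph Q" and n: "card (verts Q) \<ge> 1"
    and m: "card (edges Q) = ((d + 1) choose 2) * (card (verts Q) - 1) + d\<^sup>2"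
  shows "sparse_decomposition d Q \<longleftrightarrow> sparse_disjoint_subgraphs d Q"
proof
  have finV: "finite (verts Q)" and finQ: "finite (edges Q)"
    using Q by (auto simp: finite_multigraph_def)
  {
    assume "sparse_decomposition d Q"
    then obtain E1 E2 where E: "E1 \<inter> E2 = {}" "E1 \<union> E2 = edges Q"
      and t1: "tight d (- int d) (spanning_subgraph Q E1)"
      and t2: "tight (d choose 2) (int ((d + 1) choose 2)) (spanning_subgraph Q E2)"
      by (auto simp: sparse_decomposition_def)
    define P where "P = {..<d choose 2}"
    define W where "W = {..<(d + 1) choose 2}"
    have P: "finite P" "card P = d choose 2" and W: "finite W" "card W = (d + 1) choose 2"
      by (auto simp: P_def W_def)
    have sub: "E2 \<subseteq> edges Q" using E by blast
    obtain f where f: "bij_betw f E2 ((verts Q \<times> P) <+> W)"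
        "\<And>e j p. e \<in> E2 \<Longrightarrow> f e = Inl (j, p) \<Longrightarrow> j \<in> ends Q e"
      using tight_assignment[OF Q sub t2 P W] by blast
    \<comment> \<open>The edges in \<open>E3\<close> spanned by \<open>S\<close> are matched
      injectively with slots at vertices of \<open>S\<close>, which gives
      \<open>(d choose 2) |S|\<close> with no additive term.\<close>
    define E3 where "E3 = {e \<in> E2. f e \<in> Inl ` (verts Q \<times> P)}"
    have inj: "inj_on f E3" using f(1) by (auto simp: E3_def bij_betw_def inj_on_def)
    have "f ` E3 = Inl ` (verts Q \<times> P)"
      using f(1) by (force simp: E3_def bij_betw_def)
    then have "card E3 = card (Inl ` (verts Q \<times> P) :: (_ + nat) set)"
      using card_image[OF inj] by simp
    also have "\<dots> = card (verts Q) * (d choose 2)"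
      by (subst card_image) (simp_all add: P card_cartesian_product)
    finally have c3: "card E3 = card (verts Q) * (d choose 2)" .
    have "card {e \<in> E3. ends Q e \<subseteq> S} \<le> (d choose 2) * card S" if S: "S \<subseteq> verts Q" for S
    proof -
      have "card {e \<in> E3. ends Q e \<subseteq> S} \<le> card (Inl ` (S \<times> P) :: (_ + nat) set)"
        using inj f(2) finite_subset[OF S finV] P
        by (intro card_inj_on_le[of f]) (auto simp: E3_def inj_on_def, blast)
      also have "\<dots> = card S * (d choose 2)"
        by (subst card_image) (simp_all add: P card_cartesian_product)
      finally show ?thesis by (simp add: mult.commute)
    qed
    then have "tight (d choose 2) 0 (spanning_subgraph Q E3)"
      using c3 by (auto simp: tight_def sparsity_type_def spanning_subgraph_def simp flip: of_nat_mult)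
    then show "sparse_disjoint_subgraphs d Q"
      using E t1 unfolding sparse_disjoint_subgraphs_def
      by (intro exI[of _ E1] exI[of _ E3]) (auto simp: E3_def)
  next
    assume "sparse_disjoint_subgraphs d Q"
    then obtain E1 E2 where E: "E1 \<inter> E2 = {}" "E1 \<union> E2 \<subseteq> edges Q"
      and t1: "tight d (- int d) (spanning_subgraph Q E1)"
      and t2: "tight (d choose 2) 0 (spanning_subgraph Q E2)"
      by (auto simp: sparse_disjoint_subgraphs_def)
    define E3 where "E3 = edges Q - E1"
    have fin: "finite E1" "finite E2" "finite E3"
      using E finQ by (auto simp: E3_def intro: finite_subset)
    have c1: "int (card E1) = int d * int (card (verts Q)) - int d"
      and c2: "int (card E2) = int (d choose 2) * int (card (verts Q))"
      using t1 t2 by (auto simp: tight_def spanning_subgraph_def)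
    have Q3: "card (edges Q) = card E1 + card E3"
      using E finQ fin unfolding E3_def by (metis card_Diff_subset card_mono le_add_diff_inverse le_sup_iff)
    obtain k where k: "card (verts Q) = Suc k" using n by (cases "card (verts Q)") auto
    note ch = choose_two_identities(1)[of d]
    have "int (card (edges Q)) = int ((d choose 2) + d) * int k + (int d + 2 * int (d choose 2))"
      unfolding m k ch choose_two_identities(2)[of d, symmetric] by simp
    then have c3: "int (card E3) = int (d choose 2) * int (card (verts Q)) + int ((d + 1) choose 2)"
      using c1 Q3 unfolding k ch by (simp add: algebra_simps)
    have "int (card {e \<in> E3. ends Q e \<subseteq> S}) \<le> int (d choose 2) * int (card S) + int ((d + 1) choose 2)"
      if "S \<subseteq> verts Q" "S \<noteq> {}" for S
    proof -
      have "card {e \<in> E3. ends Q e \<subseteq> S} \<le> card ({e \<in> E2. ends Q e \<subseteq> S} \<union> (E3 - E2))"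
        using fin by (intro card_mono) auto
      also have "\<dots> \<le> card {e \<in> E2. ends Q e \<subseteq> S} + card (E3 - E2)" by (rule card_Un_le)
      also have "card (E3 - E2) = card E3 - card E2"
        using E fin by (intro card_Diff_subset) (auto simp: E3_def)
      finally have "int (card {e \<in> E3. ends Q e \<subseteq> S}) \<le>
          int (card {e \<in> E2. ends Q e \<subseteq> S}) + int (card E3 - card E2)" by linarith
      moreover have "int (card E3 - card E2) = int ((d + 1) choose 2)" using c2 c3 by linarith
      moreover have "int (card {e \<in> E2. ends Q e \<subseteq> S}) \<le> int (d choose 2) * int (card S)"
        using t2 that by (simp add: tight_def sparsity_type_def spanning_subgraph_def)
      ultimately show ?thesis by linarith
    qed
    then have "tight (d choose 2) (int ((d + 1) choose 2)) (spanning_subgraph Q E3)"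
      using c3 by (simp add: tight_def sparsity_type_def spanning_subgraph_def)
    then show "sparse_decomposition d Q"
      using E t1 unfolding sparse_decomposition_def
      by (intro exI[of _ E1] exI[of _ E3]) (auto simp: E3_def)
  }
qed

section \<open>Independent systems of functions\<close>

lemma homogeneous_system_nontrivial_solution:
  fixes a :: "'k \<Rightarrow> 'u \<Rightarrow> real"
  assumes "finite K" and "finite U" and "card K < card U"
  shows "\<exists>x. (\<exists>u\<in>U. x u \<noteq> 0) \<and> (\<forall>k\<in>K. (\<Sum>u\<in>U. a k u * x u) = 0)"
  using assms
proof (induction K arbitrary: U a rule: finite_induct)
  case empty
  then obtain u where "u \<in> U" by fastforce
  then show ?case by (intro exI[of _ "\<lambda>_. 1"]) auto
next
  case (insert k K)
  show ?case
  proof (cases "\<forall>u\<in>U. a k u = 0")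
    case True
    obtain x where "\<exists>u\<in>U. x u \<noteq> 0" "\<forall>k\<in>K. (\<Sum>u\<in>U. a k u * x u) = 0"
      using insert.IH[of U a] insert.prems insert.hyps by auto
    then show ?thesis using True by (intro exI[of _ x]) auto
  next
    case False
    then obtain u0 where u0: "u0 \<in> U" "a k u0 \<noteq> 0" by blast
    \<comment> \<open>Gaussian elimination: the unknown \<open>u0\<close> is removed from the other
      equations by means of equation \<open>k\<close>, which has a non-zero coefficient
      there.\<close>
    define b where "b k' u = a k' u - a k' u0 * a k u / a k u0" for k' u
    have "card K < card (U - {u0})"
      using insert.prems insert.hyps u0 by simp
    then obtain x where x: "\<exists>u\<in>U-{u0}. x u \<noteq> 0" "\<forall>k\<in>K. (\<Sum>u\<in>U-{u0}. b k u * x u) = 0"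
      using insert.IH[of "U - {u0}" b] insert.prems by auto
    \<comment> \<open>The value of the eliminated unknown, solved from equation
      \<open>k\<close>.\<close>
    define t where "t = - (\<Sum>u\<in>U-{u0}. a k u * x u) / a k u0"
    have sum: "(\<Sum>u\<in>U. a k' u * (x(u0 := t)) u) = a k' u0 * t + (\<Sum>u\<in>U-{u0}. a k' u * x u)" for k'
      using u0 insert.prems by (subst sum.remove[of U u0]) (auto intro!: sum.cong)
    have "(\<Sum>u\<in>U. a k' u * (x(u0 := t)) u) = 0" if "k' \<in> K" for k'
    proof -
      have "0 = (\<Sum>u\<in>U-{u0}. a k' u * x u - a k' u0 / a k u0 * (a k u * x u))"
        using x(2) that by (simp add: b_def algebra_simps)
      also have "\<dots> = (\<Sum>u\<in>U-{u0}. a k' u * x u) + a k' u0 * t"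
        by (simp only: sum_subtractf t_def sum_distrib_left[symmetric]) simp
      finally show ?thesis by (simp only: sum)
    qed
    moreover have "(\<Sum>u\<in>U. a k u * (x(u0 := t)) u) = 0"
      unfolding sum using u0 by (simp add: t_def)
    moreover have "\<exists>u\<in>U. (x(u0 := t)) u \<noteq> 0" using x(1) by auto
    ultimately show ?thesis by (intro exI[of _ "x(u0 := t)"]) blast
  qed
qed

text \<open>Independence of an indexed family of functions restricted to \<open>M\<close>. Rows are
  functions of a motion rather than vectors, so that the two parts of a row can be compared on the
  same motions.\<close>

definition lin_indep_on :: "'m set \<Rightarrow> ('e \<Rightarrow> 'm \<Rightarrow> real) \<Rightarrow> 'e set \<Rightarrow> bool" where
  "lin_indep_on M \<phi> E \<longleftrightarrow>
     (\<forall>l. (\<forall>x\<in>M. (\<Sum>e\<in>E. l e * \<phi> e x) = 0) \<longrightarrow> (\<forall>e\<in>E. l e = 0))"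

lemma lin_indep_on_card_le:
  assumes "lin_indep_on M \<phi> E" and "finite E" and "finite K"
    and "\<And>e x. e \<in> E \<Longrightarrow> x \<in> M \<Longrightarrow> \<phi> e x = (\<Sum>k\<in>K. a k e * g k x)"
  shows "card E \<le> card K"
proof (rule ccontr)
  assume "\<not> card E \<le> card K"
  then obtain l where l: "\<exists>e\<in>E. l e \<noteq> 0" "\<forall>k\<in>K. (\<Sum>e\<in>E. a k e * l e) = 0"
    using homogeneous_system_nontrivial_solution[of K E a] assms(2,3) by auto
  have "(\<Sum>e\<in>E. l e * \<phi> e x) = 0" if "x \<in> M" for x
  proof -
    have "(\<Sum>e\<in>E. l e * \<phi> e x) = (\<Sum>e\<in>E. \<Sum>k\<in>K. a k e * l e * g k x)"
      using assms(4) that by (intro sum.cong) (auto simp: sum_distrib_left algebra_simps)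
    also have "\<dots> = (\<Sum>k\<in>K. (\<Sum>e\<in>E. a k e * l e) * g k x)"
      by (subst sum.swap) (simp add: sum_distrib_right)
    finally show ?thesis using l(2) by simp
  qed
  then show False using assms(1) l(1) by (auto simp: lin_indep_on_def)
qed

lemma lin_indep_on_cong:
  assumes "lin_indep_on M \<phi> E" and "\<And>e x. e \<in> E \<Longrightarrow> x \<in> M \<Longrightarrow> \<phi> e x = \<psi> e x"
  shows "lin_indep_on M \<psi> E"
proof -
  have "(\<Sum>e\<in>E. l e * \<psi> e x) = (\<Sum>e\<in>E. l e * \<phi> e x)" if "x \<in> M" for l x
    using assms(2) that by (intro sum.cong) auto
  then show ?thesis using assms(1) by (simp add: lin_indep_on_def)
qed

lemma lin_indep_on_subset:
  assumes "lin_indep_on M \<phi> E" "finite E" "F \<subseteq> E"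
  shows "lin_indep_on M \<phi> F"
  unfolding lin_indep_on_def
proof (intro allI impI)
  fix l assume l: "\<forall>x\<in>M. (\<Sum>e\<in>F. l e * \<phi> e x) = 0"
  have "(\<Sum>e\<in>E. (if e \<in> F then l e else 0) * \<phi> e x) = (\<Sum>e\<in>F. l e * \<phi> e x)" for x
    using assms by (intro sum.mono_neutral_cong_right) auto
  then have "\<forall>e\<in>E. (if e \<in> F then l e else 0) = 0"
    using assms(1)[unfolded lin_indep_on_def, THEN spec, of "\<lambda>e. if e \<in> F then l e else 0"] l by simp
  then show "\<forall>e\<in>F. l e = 0" using assms(3) by (metis subsetD)
qed

text \<open>If both replacements were dependent, each of the two parts would be a combination of the
  other rows, since those rows are independent among themselves. Then so would be their sum, the
  original row.\<close>

lemma lin_indep_on_replace: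
  assumes ind: "lin_indep_on M \<phi> E" and fin: "finite E" and e0: "e0 \<in> E"
    and split: "\<And>x. x \<in> M \<Longrightarrow> \<phi> e0 x = \<phi>1 x + \<phi>2 x"
  shows "lin_indep_on M (\<phi>(e0 := \<phi>1)) E \<or> lin_indep_on M (\<phi>(e0 := \<phi>2)) E"
proof (rule ccontr)
  assume neg: "\<not> ?thesis"
  have comb: "\<exists>l. \<forall>x\<in>M. \<psi> x = (\<Sum>e\<in>E-{e0}. l e * \<phi> e x)"
    if dep: "\<not> lin_indep_on M (\<phi>(e0 := \<psi>)) E" for \<psi>
  proof -
    obtain l where l: "\<forall>x\<in>M. (\<Sum>e\<in>E. l e * (\<phi>(e0 := \<psi>)) e x) = 0" "\<exists>e\<in>E. l e \<noteq> 0"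
      using dep unfolding lin_indep_on_def by blast
    have sum: "l e0 * \<psi> x + (\<Sum>e\<in>E-{e0}. l e * \<phi> e x) = 0" if "x \<in> M" for x
      using l(1)[rule_format, OF that] fin e0 by (subst (asm) sum.remove[of _ e0]) auto
    have "l e0 \<noteq> 0"
    proof
      assume 0: "l e0 = 0"
      have "(\<Sum>e\<in>E. l e * \<phi> e x) = 0" if "x \<in> M" for x
        using sum[OF that] 0 fin e0 by (subst sum.remove[of _ e0]) auto
      then show False using ind l(2) by (auto simp: lin_indep_on_def)
    qed
    have "\<psi> x = (\<Sum>e\<in>E-{e0}. (- l e / l e0) * \<phi> e x)" if "x \<in> M" for x
    proof -
      have "\<psi> x = - (\<Sum>e\<in>E-{e0}. l e * \<phi> e x) / l e0"
        using sum[OF that] \<open>l e0 \<noteq> 0\<close> by (simp add: field_simps)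
      then show ?thesis by (simp add: sum_divide_distrib sum_negf)
    qed
    then show ?thesis by (intro exI[of _ "\<lambda>e. - l e / l e0"]) simp
  qed
  obtain l1 l2 where l: "\<forall>x\<in>M. \<phi>1 x = (\<Sum>e\<in>E-{e0}. l1 e * \<phi> e x)"
      "\<forall>x\<in>M. \<phi>2 x = (\<Sum>e\<in>E-{e0}. l2 e * \<phi> e x)"
    using comb[of \<phi>1] comb[of \<phi>2] neg by auto
  define l where "l e = (if e = e0 then 1 else - l1 e - l2 e)" for e
  have "(\<Sum>e\<in>E. l e * \<phi> e x) = 0" if "x \<in> M" for x
  proof -
    have "(\<Sum>e\<in>E. l e * \<phi> e x) = \<phi> e0 x + (\<Sum>e\<in>E-{e0}. (- l1 e - l2 e) * \<phi> e x)"
      using fin e0 by (subst sum.remove[of _ e0]) (auto simp: l_def intro!: sum.cong)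
    also have "\<dots> = 0"
      using split[OF that] l that by (simp add: algebra_simps sum_subtractf sum_negf)
    finally show ?thesis .
  qed
  then have "l e0 = 0" using ind e0 unfolding lin_indep_on_def by blast
  then show False by (simp add: l_def)
qed

text \<open>This does the work of a Laplace expansion: some choice of one part per row keeps the
  whole family independent, and subfamilies inherit independence.\<close>

lemma lin_indep_on_split:
  assumes ind: "lin_indep_on M \<phi> E" and fin: "finite E"
    and split: "\<And>e x. e \<in> E \<Longrightarrow> x \<in> M \<Longrightarrow> \<phi> e x = \<phi>1 e x + \<phi>2 e x"
  shows "\<exists>E1 E2. E1 \<inter> E2 = {} \<and> E1 \<union> E2 = E \<and> lin_indep_on M \<phi>1 E1 \<and> lin_indep_on M \<phi>2 E2"
proof -
  \<comment> \<open>Invariant: the rows in \<open>F\<close> have been replaced, those in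
    \<open>E1\<close> by their first part, while the rows outside \<open>F\<close> are still
    intact.\<close>
  have "\<exists>E1 \<subseteq> F. lin_indep_on M (\<lambda>e. if e \<in> E1 then \<phi>1 e else if e \<in> F then \<phi>2 e else \<phi> e) E"
    if "F \<subseteq> E" for F
    using finite_subset[OF that fin] that
  proof (induction F rule: finite_induct)
    case empty
    then show ?case using ind by simp
  next
    case (insert e0 F)
    then obtain E1 where E1: "E1 \<subseteq> F"
      "lin_indep_on M (\<lambda>e. if e \<in> E1 then \<phi>1 e else if e \<in> F then \<phi>2 e else \<phi> e) E"
      (is "lin_indep_on M ?\<psi> E") by auto
    have "e0 \<in> E" using insert by auto
    moreover have "?\<psi> e0 x = \<phi>1 e0 x + \<phi>2 e0 x" if "x \<in> M" for x
      using split[OF \<open>e0 \<in> E\<close> that] insert.hyps E1(1) by auto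
    ultimately consider "lin_indep_on M (?\<psi>(e0 := \<phi>1 e0)) E" | "lin_indep_on M (?\<psi>(e0 := \<phi>2 e0)) E"
      using lin_indep_on_replace[OF E1(2) fin] by blast
    then show ?case
    proof cases
      case 1
      have "?\<psi>(e0 := \<phi>1 e0) =
          (\<lambda>e. if e \<in> insert e0 E1 then \<phi>1 e else if e \<in> insert e0 F then \<phi>2 e else \<phi> e)"
        by auto
      then show ?thesis using 1 E1(1) by (intro exI[of _ "insert e0 E1"]) auto
    next
      case 2
      have "?\<psi>(e0 := \<phi>2 e0) =
          (\<lambda>e. if e \<in> E1 then \<phi>1 e else if e \<in> insert e0 F then \<phi>2 e else \<phi> e)"
        using E1(1) insert.hyps by (auto simp: fun_eq_iff)
      then show ?thesis using 2 E1(1) by (intro exI[of _ E1]) auto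
    qed
  qed
  then obtain E1 where E1: "E1 \<subseteq> E"
    "lin_indep_on M (\<lambda>e. if e \<in> E1 then \<phi>1 e else if e \<in> E then \<phi>2 e else \<phi> e) E" (is "lin_indep_on M ?\<psi> E")
    by blast
  have "lin_indep_on M ?\<psi> E1" "lin_indep_on M ?\<psi> (E - E1)"
    using lin_indep_on_subset[OF E1(2) fin] E1(1) by auto
  then have "lin_indep_on M \<phi>1 E1" "lin_indep_on M \<phi>2 (E - E1)"
    by (auto elim: lin_indep_on_cong)
  then show ?thesis using E1(1) by (intro exI[of _ E1] exI[of _ "E - E1"]) auto
qed

section \<open>Directions with independent rows\<close>

definition dir_row :: "('e \<Rightarrow> 'v) \<Rightarrow> ('e \<Rightarrow> 'v) \<Rightarrow> ('e \<Rightarrow> real ^ 'd::finite) \<Rightarrow> 'e \<Rightarrow> ('v \<Rightarrow> real ^ 'd) \<Rightarrow> real" where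
  "dir_row s t v e p = v e \<bullet> (p (t e) - p (s e))"

text \<open>Independence in dual form: every edge has a velocity field seen by its own row alone.
  These fields later give explicit solutions, and they can be corrected when a direction is
  perturbed.\<close>

definition dual_family :: "('e \<Rightarrow> 'v) \<Rightarrow> ('e \<Rightarrow> 'v) \<Rightarrow> ('e \<Rightarrow> real ^ 'd::finite) \<Rightarrow> 'e set \<Rightarrow> bool" where
  "dual_family s t v E \<longleftrightarrow>
     (\<forall>e\<in>E. \<exists>p. dir_row s t v e p = 1 \<and> (\<forall>f\<in>E-{e}. dir_row s t v f p = 0))"

lemma dir_row_lincomb:
  "dir_row s t v e (\<lambda>u. p u + a *\<^sub>R q u) = dir_row s t v e p + a * dir_row s t v e q"
  by (simp add: dir_row_def algebra_simps)

lemma dir_row_diff_sum: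
  "dir_row s t v e (\<lambda>u. p u - (\<Sum>i\<in>I. a i *\<^sub>R q i u)) =
     dir_row s t v e p - (\<Sum>i\<in>I. a i * dir_row s t v e (q i))"
  by (induction I rule: infinite_finite_induct)
     (auto simp: dir_row_def algebra_simps)

text \<open>A field \<open>p\<close> that the old rows do not see but the new row does is, after
  scaling, dual to the new edge. Adding multiples of it repairs the old dual fields without changing
  the old rows.\<close>

lemma dual_family_insert:
  assumes dual: "dual_family s t v E" and e0: "e0 \<notin> E"
    and p: "\<And>f. f \<in> E \<Longrightarrow> dir_row s t v f p = 0"
    and w: "w \<bullet> (p (t e0) - p (s e0)) \<noteq> 0"
  shows "dual_family s t (v(e0 := w)) (insert e0 E)"
  unfolding dual_family_def
proof
  fix e assume e: "e \<in> insert e0 E"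
  let ?v = "v(e0 := w)" and ?r = "w \<bullet> (p (t e0) - p (s e0))"
  have old: "dir_row s t ?v f q = dir_row s t v f q" if "f \<in> E" for f q
    using that e0 by (auto simp: dir_row_def)
  have new: "dir_row s t ?v e0 p = ?r" by (simp add: dir_row_def)
  show "\<exists>q. dir_row s t ?v e q = 1 \<and> (\<forall>f\<in>insert e0 E - {e}. dir_row s t ?v f q = 0)"
  proof (cases "e = e0")
    case True
    have "dir_row s t ?v e0 (\<lambda>u. 0 + (1 / ?r) *\<^sub>R p u) = 1"
      unfolding dir_row_lincomb new using w by (simp add: dir_row_def)
    moreover have "dir_row s t ?v f (\<lambda>u. 0 + (1 / ?r) *\<^sub>R p u) = 0" if "f \<in> E" for f
      unfolding dir_row_lincomb using old[OF that] p[OF that] by (simp add: dir_row_def)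
    ultimately show ?thesis using True by (intro exI[of _ "\<lambda>u. 0 + (1 / ?r) *\<^sub>R p u"]) auto
  next
    case False
    with e have eE: "e \<in> E" by simp
    then obtain q where q: "dir_row s t v e q = 1" "\<And>f. f \<in> E - {e} \<Longrightarrow> dir_row s t v f q = 0"
      using dual unfolding dual_family_def by blast
    define a where "a = - dir_row s t ?v e0 q / ?r"
    have "dir_row s t ?v e0 (\<lambda>u. q u + a *\<^sub>R p u) = 0"
      unfolding dir_row_lincomb new a_def using w by simp
    moreover have "dir_row s t ?v f (\<lambda>u. q u + a *\<^sub>R p u) = dir_row s t v f q" if "f \<in> E" for f
      unfolding dir_row_lincomb old[OF that] p[OF that] by simp
    ultimately have "dir_row s t ?v e (\<lambda>u. q u + a *\<^sub>R p u) = 1"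
      and "\<forall>f\<in>insert e0 E - {e}. dir_row s t ?v f (\<lambda>u. q u + a *\<^sub>R p u) = 0"
      using q eE by force+
    then show ?thesis by blast
  qed
qed

text \<open>This takes the place of the decomposition into \<open>d\<close> forests. Directions \<open>v\<close> of all edges
  but one are chosen to leave as few pairs of vertices as possible in forced agreement. If the last
  edge joined such a pair, its class of vertices would span too many edges.\<close>

lemma generic_directions:
  fixes s t :: "'e \<Rightarrow> 'v"
  assumes fin: "finite V" "finite E" and ends: "\<And>e. e \<in> E \<Longrightarrow> s e \<in> V \<and> t e \<in> V"
    and sparse: "\<And>S. S \<subseteq> V \<Longrightarrow> S \<noteq> {} \<Longrightarrow>
      card {e\<in>E. s e \<in> S \<and> t e \<in> S} + CARD('d) \<le> CARD('d::finite) * card S"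
  shows "\<exists>v :: 'e \<Rightarrow> real ^ 'd. dual_family s t v E"
  using fin(2) ends sparse
proof (induction E rule: finite_induct)
  case empty
  then show ?case by (simp add: dual_family_def)
next
  case (insert e0 E)
  define K :: "('e \<Rightarrow> real ^ 'd) \<Rightarrow> ('v \<Rightarrow> real ^ 'd) set"
    where "K v = {p. \<forall>f\<in>E. dir_row s t v f p = 0}" for v
  \<comment> \<open>The pairs of vertices that have equal velocity in every field annihilated by the
    rows of \<open>E\<close>.\<close>
  define eqv where "eqv v = {(u, w) \<in> V \<times> V. \<forall>p\<in>K v. p u = p w}" for v
  have fin_eqv: "finite (eqv v)" for v
    by (rule finite_subset[of _ "V \<times> V"]) (use fin(1) in \<open>auto simp: eqv_def\<close>)
  have e0V: "s e0 \<in> V" "t e0 \<in> V" using insert.prems(1)[of e0] by auto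
  have sE: "s e \<in> V" "t e \<in> V" if "e \<in> E" for e using insert.prems(1)[of e] that by auto
  have "\<exists>v :: 'e \<Rightarrow> real ^ 'd. dual_family s t v E"
  proof (rule insert.IH)
    show "s e \<in> V \<and> t e \<in> V" if "e \<in> E" for e using sE[OF that] by simp
    fix S assume S: "S \<subseteq> V" "S \<noteq> {}"
    have "card {e\<in>E. s e \<in> S \<and> t e \<in> S} \<le> card {e\<in>insert e0 E. s e \<in> S \<and> t e \<in> S}"
      using insert.hyps by (intro card_mono) auto
    then show "card {e\<in>E. s e \<in> S \<and> t e \<in> S} + CARD('d) \<le> CARD('d) * card S"
      using insert.prems(2)[OF S] by linarith
  qed
  then obtain v0 :: "'e \<Rightarrow> real ^ 'd" where "dual_family s t v0 E" by blast
  then obtain v :: "'e \<Rightarrow> real ^ 'd" where v: "dual_family s t v E"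
    and vmin: "\<And>v'. dual_family s t v' E \<Longrightarrow> card (eqv v) \<le> card (eqv v')"
    using ex_has_least_nat[of "\<lambda>v. dual_family s t v E" v0 "\<lambda>v. card (eqv v)"] by blast
  show ?case
  proof (cases "(s e0, t e0) \<in> eqv v")
    case False
    then obtain p where p: "p \<in> K v" "p (s e0) \<noteq> p (t e0)" using e0V by (auto simp: eqv_def)
    \<comment> \<open>Taking the relative velocity itself as the direction makes its inner product
      with that velocity a non-zero square norm.\<close>
    have "dual_family s t (v(e0 := p (t e0) - p (s e0))) (insert e0 E)"
      using p by (intro dual_family_insert[OF v insert.hyps(2), of p]) (auto simp: K_def)
    then show ?thesis by blast
  next
    case True
    \<comment> \<open>Tilting the direction of \<open>e\<close> slightly would otherwise separate \<open>u\<close> from \<open>w\<close>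
      while keeping all separated pairs separated.\<close>
    have dual_const: "q u = q w"
      if e: "e \<in> E" "(s e, t e) \<notin> eqv v" and q: "dir_row s t v e q = 1"
        "\<And>f. f \<in> E - {e} \<Longrightarrow> dir_row s t v f q = 0" and uw: "(u, w) \<in> eqv v" for e q u w
    proof (rule ccontr)
      assume neq: "q u \<noteq> q w"
      obtain p1 where p1: "p1 \<in> K v" "p1 (s e) \<noteq> p1 (t e)" using e sE by (auto simp: eqv_def)
      define z where "z = p1 (t e) - p1 (s e)"
      define \<beta> where "\<beta> = z \<bullet> (q (t e) - q (s e))"
      \<comment> \<open>After tilting by \<open>\<epsilon> *\<^sub>R z\<close>, the row of
        \<open>e\<close> takes the value
        \<open>\<epsilon> * (z \<bullet> (p (t e) - p (s e)))\<close> on an old solution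
        \<open>p\<close>, and \<open>1 + \<epsilon> * \<beta>\<close> on \<open>q\<close>. This
        coefficient makes \<open>p\<close> plus a multiple of \<open>q\<close> a solution for the
        tilted directions.\<close>
      define \<alpha> where "\<alpha> \<epsilon> p = - \<epsilon> * (z \<bullet> (p (t e) - p (s e))) / (1 + \<epsilon> * \<beta>)" for \<epsilon> and p :: "'v \<Rightarrow> real ^ 'd"
      define v' where "v' \<epsilon> = v(e := v e + \<epsilon> *\<^sub>R z)" for \<epsilon>
      have K': "(\<lambda>u. p u + \<alpha> \<epsilon> p *\<^sub>R q u) \<in> K (v' \<epsilon>)" if p: "p \<in> K v" and \<epsilon>: "1 + \<epsilon> * \<beta> \<noteq> 0" for p \<epsilon>
      proof -
        have "dir_row s t (v' \<epsilon>) f (\<lambda>u. p u + \<alpha> \<epsilon> p *\<^sub>R q u) = 0" if "f \<in> E" for f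
        proof (cases "f = e")
          case True
          have "dir_row s t (v' \<epsilon>) e p = \<epsilon> * (z \<bullet> (p (t e) - p (s e)))"
            using p e(1) by (auto simp: K_def dir_row_def v'_def inner_add_left)
          moreover have "dir_row s t (v' \<epsilon>) e q = 1 + \<epsilon> * \<beta>"
            using q(1) by (auto simp: dir_row_def v'_def inner_add_left \<beta>_def)
          ultimately show ?thesis unfolding True dir_row_lincomb using \<epsilon> by (simp add: \<alpha>_def)
        next
          case False
          have "dir_row s t (v' \<epsilon>) f g = dir_row s t v f g" for g
            using False by (simp add: dir_row_def v'_def)
          then show ?thesis using p q(2)[of f] that False by (simp add: dir_row_lincomb K_def)
        qed
        then show ?thesis by (simp add: K_def)
      qed
      have dual': "dual_family s t (v' \<epsilon>) E" if \<epsilon>: "1 + \<epsilon> * \<beta> \<noteq> 0" for \<epsilon>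
      proof -
        have "dual_family s t v (E - {e})"
          using v unfolding dual_family_def by blast
        moreover have "(v e + \<epsilon> *\<^sub>R z) \<bullet> (q (t e) - q (s e)) \<noteq> 0"
          using q(1) \<epsilon> by (simp add: dir_row_def inner_add_left \<beta>_def)
        ultimately have "dual_family s t (v' \<epsilon>) (insert e (E - {e}))"
          unfolding v'_def using q(2) by (intro dual_family_insert[of _ _ _ _ _ q]) auto
        then show ?thesis using e(1) by (simp add: insert_absorb)
      qed
      \<comment> \<open>The separated pairs. There are finitely many, each with a separating field
        \<open>P x\<close>, and the correction tends to 0 with \<epsilon>, so all of them stay
        separated for some positive \<epsilon>.\<close>
      define N where "N = V \<times> V - eqv v"
      have "\<exists>p. p \<in> K v \<and> p (fst x) \<noteq> p (snd x)" if "x \<in> N" for x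
        using that by (auto simp: N_def eqv_def)
      then obtain P where P: "\<And>x. x \<in> N \<Longrightarrow> P x \<in> K v \<and> P x (fst x) \<noteq> P x (snd x)" by metis
      have lim: "((\<lambda>\<epsilon>. \<alpha> \<epsilon> p) \<longlongrightarrow> 0) (at_right 0)" for p
        unfolding \<alpha>_def by (auto intro!: tendsto_eq_intros)
      have ev1: "eventually (\<lambda>\<epsilon>. \<forall>x\<in>N. (P x (fst x) - P x (snd x)) + \<alpha> \<epsilon> (P x) *\<^sub>R (q (fst x) - q (snd x)) \<noteq> 0) (at_right 0)"
      proof (rule eventually_ball_finite)
        show "finite N" using fin(1) by (simp add: N_def)
        show "\<forall>x\<in>N. eventually (\<lambda>\<epsilon>. (P x (fst x) - P x (snd x)) + \<alpha> \<epsilon> (P x) *\<^sub>R (q (fst x) - q (snd x)) \<noteq> 0) (at_right 0)"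
        proof
          fix x assume x: "x \<in> N"
          have "((\<lambda>\<epsilon>. (P x (fst x) - P x (snd x)) + \<alpha> \<epsilon> (P x) *\<^sub>R (q (fst x) - q (snd x)))
              \<longlongrightarrow> P x (fst x) - P x (snd x)) (at_right 0)"
            by (auto intro!: tendsto_eq_intros lim)
          then show "eventually (\<lambda>\<epsilon>. (P x (fst x) - P x (snd x)) + \<alpha> \<epsilon> (P x) *\<^sub>R (q (fst x) - q (snd x)) \<noteq> 0) (at_right 0)"
            using P[OF x] by (intro tendsto_imp_eventually_ne) auto
        qed
      qed
      have "((\<lambda>\<epsilon>. 1 + \<epsilon> * \<beta>) \<longlongrightarrow> 1) (at_right 0)" by (auto intro!: tendsto_eq_intros)
      then have ev2: "eventually (\<lambda>\<epsilon>. 1 + \<epsilon> * \<beta> \<noteq> 0) (at_right 0)"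
        by (intro tendsto_imp_eventually_ne) auto
      have ev3: "eventually (\<lambda>\<epsilon>. \<epsilon> > 0) (at_right (0::real))" by (rule eventually_at_right_less)
      obtain \<epsilon> where \<epsilon>: "1 + \<epsilon> * \<beta> \<noteq> 0" "\<epsilon> > 0"
        "\<And>x. x \<in> N \<Longrightarrow> (P x (fst x) - P x (snd x)) + \<alpha> \<epsilon> (P x) *\<^sub>R (q (fst x) - q (snd x)) \<noteq> 0"
        using eventually_happens'[OF trivial_limit_at_right_real eventually_conj[OF ev1 eventually_conj[OF ev2 ev3]]]
        by blast
      have "eqv (v' \<epsilon>) \<subseteq> eqv v"
      proof (rule subsetI, rule ccontr)
        fix x assume x: "x \<in> eqv (v' \<epsilon>)" "x \<notin> eqv v"
        then have xN: "x \<in> N" by (auto simp: N_def eqv_def)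
        have "P x (fst x) + \<alpha> \<epsilon> (P x) *\<^sub>R q (fst x) = P x (snd x) + \<alpha> \<epsilon> (P x) *\<^sub>R q (snd x)"
          using x(1) K'[OF conjunct1[OF P[OF xN]] \<epsilon>(1)] by (auto simp: eqv_def)
        then show False using \<epsilon>(3)[OF xN] by (simp add: algebra_simps)
      qed
      moreover have "(u, w) \<notin> eqv (v' \<epsilon>)"
      proof
        assume "(u, w) \<in> eqv (v' \<epsilon>)"
        then have "p1 u + \<alpha> \<epsilon> p1 *\<^sub>R q u = p1 w + \<alpha> \<epsilon> p1 *\<^sub>R q w"
          using K'[OF p1(1) \<epsilon>(1)] by (auto simp: eqv_def)
        moreover have "p1 u = p1 w" using uw p1(1) by (auto simp: eqv_def)
        \<comment> \<open>The numerator is a non-zero multiple of \<open>z \<bullet> z\<close>, as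
          \<open>z\<close> is the relative velocity of \<open>p1\<close> itself. Since
          \<open>p1\<close> agrees at \<open>u\<close> and \<open>w\<close> but \<open>q\<close>
          does not, the corrected field separates this pair, against minimality.\<close>
        moreover have "\<alpha> \<epsilon> p1 \<noteq> 0"
          using \<epsilon>(1,2) p1(2) by (simp add: \<alpha>_def z_def)
        ultimately show False using neq by simp
      qed
      ultimately have "card (eqv (v' \<epsilon>)) < card (eqv v)"
        using uw by (intro psubset_card_mono fin_eqv) auto
      then show False using vmin[OF dual'[OF \<epsilon>(1)]] by simp
    qed
    \<comment> \<open>The edges with both ends in one class, and the class containing both ends of
      \<open>e0\<close>.\<close>
    define X where "X = {e\<in>E. (s e, t e) \<in> eqv v}"
    define S where "S = {u\<in>V. (u, s e0) \<in> eqv v}"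
    have eqv_sym: "(w, u) \<in> eqv v" if "(u, w) \<in> eqv v" for u w
      using that by (auto simp: eqv_def)
    have eqv_trans: "(u, x) \<in> eqv v" if "(u, w) \<in> eqv v" "(w, x) \<in> eqv v" for u w x
      using that by (auto simp: eqv_def)
    have S0: "s e0 \<in> S" "t e0 \<in> S" and SV: "S \<subseteq> V"
      using e0V True by (auto simp: S_def eqv_def)
    have finS: "finite S" using finite_subset[OF SV fin(1)] .
    have "\<exists>q. dir_row s t v e q = 1 \<and> (\<forall>f\<in>E-{e}. dir_row s t v f q = 0)" if "e \<in> E" for e
      using v that by (auto simp: dual_family_def)
    then obtain q where q: "\<And>e. e \<in> E \<Longrightarrow> dir_row s t v e (q e) = 1"
        "\<And>e f. e \<in> E \<Longrightarrow> f \<in> E \<Longrightarrow> f \<noteq> e \<Longrightarrow> dir_row s t v f (q e) = 0"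
      by (metis (no_types) Diff_iff singletonD)
    \<comment> \<open>The rows in \<open>X\<close> alone already force agreement on
      \<open>S\<close>: the other rows can be made to vanish by subtracting their dual fields, and
      these are constant on \<open>S\<close> by \<open>dual_const\<close>.\<close>
    have const: "p u = p (s e0)" if p: "\<And>e. e \<in> X \<Longrightarrow> dir_row s t v e p = 0" and u: "u \<in> S" for p u
    proof -
      define p' where "p' u = p u - (\<Sum>e\<in>E-X. dir_row s t v e p *\<^sub>R q e u)" for u
      have "dir_row s t v f p' = 0" if f: "f \<in> E" for f
      proof -
        have "(\<Sum>e\<in>E-X. dir_row s t v e p * dir_row s t v f (q e)) =
            (\<Sum>e\<in>E-X. if e = f then dir_row s t v f p else 0)"
          using q f by (intro sum.cong) auto
        also have "\<dots> = dir_row s t v f p"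
          using f p[of f] insert.hyps(1) by (simp add: sum.delta)
        finally show ?thesis unfolding p'_def dir_row_diff_sum by simp
      qed
      then have "p' \<in> K v" by (simp add: K_def)
      then have "p' u = p' (s e0)" using u by (auto simp: S_def eqv_def)
      moreover have "q e u = q e (s e0)" if "e \<in> E - X" for e
        using that u q by (intro dual_const[of e]) (auto simp: X_def S_def)
      ultimately show ?thesis by (simp add: p'_def)
    qed
    define XS where "XS = {e\<in>X. s e \<in> S \<and> t e \<in> S}"
    have finXS: "finite XS" using insert.hyps(1) by (auto simp: XS_def X_def)
    \<comment> \<open>Coordinates of velocity fields on \<open>S\<close> that vanish at
      \<open>s e0\<close>. With fewer rows than coordinates there would be a non-zero such field,
      against \<open>const\<close>. Hence \<open>S\<close> spans at least \<open>d (|S| - 1)\<close>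
      edges besides \<open>e0\<close>, one too many in total.\<close>
    define U where "U = (S - {s e0}) \<times> (UNIV :: 'd set)"
    have "card U \<le> card XS"
    proof (rule ccontr)
      assume "\<not> ?thesis"
      then have lt: "card XS < card U" by simp
      define a where "a e uk = v e $ snd uk * (of_bool (t e = fst uk) - of_bool (s e = fst uk))" for e and uk :: "'v \<times> 'd"
      have "finite U" using finS by (simp add: U_def)
      then obtain x where x: "\<exists>u\<in>U. x u \<noteq> 0" "\<forall>k\<in>XS. (\<Sum>u\<in>U. a k u * x u) = 0"
        using homogeneous_system_nontrivial_solution[OF finXS _ lt, of a] by blast
      define p :: "'v \<Rightarrow> real ^ 'd" where "p u = (\<chi> k. if u \<in> S - {s e0} then x (u, k) else 0)" for u
      have "dir_row s t v e p = 0" if e: "e \<in> X" for e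
      proof (cases "e \<in> XS")
        case True
        have del: "(\<Sum>u\<in>S-{s e0}. of_bool (y = u) * x (u, k)) = p y $ k" if "y \<in> S" for y k
        proof -
          have "(\<Sum>u\<in>S-{s e0}. of_bool (y = u) * x (u, k)) = (\<Sum>u\<in>S-{s e0}. if y = u then x (u, k) else 0)"
            by (intro sum.cong) auto
          then show ?thesis using finS by (simp add: sum.delta p_def)
        qed
        have "0 = (\<Sum>u\<in>S-{s e0}. \<Sum>k\<in>UNIV. a e (u, k) * x (u, k))"
          using x(2) True by (simp add: U_def sum.cartesian_product)
        also have "\<dots> = (\<Sum>k\<in>UNIV. v e $ k * ((\<Sum>u\<in>S-{s e0}. of_bool (t e = u) * x (u, k)) -
             (\<Sum>u\<in>S-{s e0}. of_bool (s e = u) * x (u, k))))"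
          by (subst sum.swap) (simp add: a_def sum_distrib_left sum_subtractf[symmetric] algebra_simps)
        also have "\<dots> = dir_row s t v e p"
          using True by (simp add: XS_def del dir_row_def inner_vec_def)
        finally show ?thesis by simp
      next
        case False
        \<comment> \<open>An edge of \<open>X\<close> outside \<open>XS\<close> avoids the class
          \<open>S\<close> altogether, and \<open>p\<close> vanishes there.\<close>
        have "(s e, t e) \<in> eqv v" using e by (simp add: X_def)
        then have "s e \<in> S \<longleftrightarrow> t e \<in> S"
          using eqv_trans[of "s e" "t e" "s e0"] eqv_trans[of "t e" "s e" "s e0"] eqv_sym[of "s e" "t e"] e sE[of e]
          by (auto simp: S_def X_def)
        then have "s e \<notin> S \<and> t e \<notin> S"
          using False e by (auto simp: XS_def)
        then have "p (s e) = p (t e)" by (simp add: p_def)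
        then show ?thesis by (simp add: dir_row_def)
      qed
      then have "p u = p (s e0)" if "u \<in> S" for u using const that by blast
      moreover have "p (s e0) = 0" by (simp add: p_def vec_eq_iff)
      moreover obtain u k where uk: "(u, k) \<in> U" "x (u, k) \<noteq> 0" using x(1) by auto
      moreover have "p u $ k = x (u, k)" using uk by (simp add: p_def U_def)
      ultimately show False by (auto simp: U_def)
    qed
    moreover have "card U = (card S - 1) * CARD('d)"
      using finS S0 by (simp add: U_def card_cartesian_product)
    moreover have "card (insert e0 XS) + CARD('d) \<le> CARD('d) * card S"
    proof -
      have "card (insert e0 XS) \<le> card {e\<in>insert e0 E. s e \<in> S \<and> t e \<in> S}"
        using insert.hyps(1) S0 by (intro card_mono) (auto simp: XS_def X_def)
      then show ?thesis using insert.prems(2)[OF SV] S0 by fastforce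
    qed
    moreover have "card (insert e0 XS) = Suc (card XS)"
      using finXS insert.hyps(2) by (simp add: XS_def X_def)
    moreover obtain k where "card S = Suc k" using finS S0 by (cases "card S") auto
    ultimately have False by (simp add: mult.commute)
    then show ?thesis ..
  qed
qed

section \<open>Counting independent rows\<close>

text \<open>The positions strictly above the diagonal, which are coordinates for skew-symmetric
  matrices. The index type is only finite, so an order is borrowed from an enumeration.\<close>

definition less_pairs :: "('d::finite \<times> 'd) set" where
  "less_pairs = {(k, l). to_nat_on UNIV k < to_nat_on UNIV l}"

lemma card_less_pairs: "card (less_pairs :: ('d::finite \<times> 'd) set) = CARD('d) choose 2"
proof -
  let ?f = "to_nat_on (UNIV :: 'd set)"
  have inj: "?f k = ?f l \<longleftrightarrow> k = l" for k l
    using inj_on_to_nat_on[of "UNIV :: 'd set"] by (auto simp: inj_on_def countable_finite)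
  have "bij_betw (\<lambda>(k, l). {k, l}) (less_pairs :: ('d \<times> 'd) set) {B. B \<subseteq> UNIV \<and> card B = 2}"
  proof (rule bij_betwI')
    fix x y :: "'d \<times> 'd" assume "x \<in> less_pairs" "y \<in> less_pairs"
    then show "((case x of (k, l) \<Rightarrow> {k, l}) = (case y of (k, l) \<Rightarrow> {k, l})) = (x = y)"
      by (auto simp: less_pairs_def doubleton_eq_iff)
  next
    fix x :: "'d \<times> 'd" assume "x \<in> less_pairs"
    then show "(case x of (k, l) \<Rightarrow> {k, l}) \<in> {B. B \<subseteq> UNIV \<and> card B = 2}"
      by (auto simp: less_pairs_def card_2_iff)
  next
    fix B :: "'d set" assume "B \<in> {B. B \<subseteq> UNIV \<and> card B = 2}"
    then obtain k l where B: "B = {k, l}" "k \<noteq> l" by (auto simp: card_2_iff)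
    have "?f k \<noteq> ?f l" using inj[of k l] B(2) by simp
    then have "(k, l) \<in> less_pairs \<or> (l, k) \<in> less_pairs"
      by (simp only: less_pairs_def mem_Collect_eq case_prod_conv nat_neq_iff)
    then show "\<exists>x\<in>less_pairs. B = (case x of (k, l) \<Rightarrow> {k, l})"
      using B by (force simp: insert_commute)
  qed
  then have "card (less_pairs :: ('d \<times> 'd) set) = card {B :: 'd set. B \<subseteq> UNIV \<and> card B = 2}"
    by (rule bij_betw_same_card)
  then show ?thesis using n_subsets[of "UNIV :: 'd set" 2] by simp
qed

lemma pairs_trichotomy:
  "(UNIV :: ('d::finite \<times> 'd) set) = less_pairs \<union> prod.swap ` less_pairs \<union> range (\<lambda>k. (k, k))"
proof -
  have inj: "to_nat_on UNIV k = to_nat_on UNIV l \<longleftrightarrow> k = l" for k l :: 'd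
    using inj_on_to_nat_on[of "UNIV :: 'd set"] by (auto simp: inj_on_def countable_finite)
  have "x \<in> less_pairs \<union> prod.swap ` less_pairs \<union> range (\<lambda>k. (k, k))" for x :: "'d \<times> 'd"
  proof -
    obtain k l where x: "x = (k, l)" by (cases x)
    consider "to_nat_on UNIV k < to_nat_on UNIV l" | "to_nat_on UNIV l < to_nat_on UNIV k" | "k = l"
      using inj[of k l] by linarith
    then show ?thesis
    proof cases
      case 2
      then have "(l, k) \<in> less_pairs" by (simp add: less_pairs_def)
      then have "prod.swap (l, k) \<in> prod.swap ` less_pairs" by (rule imageI)
      then show ?thesis using x by simp
    qed (auto simp: x less_pairs_def)
  qed
  then show ?thesis by blast
qed

lemma less_pairs_not_diag [simp]: "(k, k) \<notin> less_pairs"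
  by (simp add: less_pairs_def)

lemma less_pairs_asym: "(k, l) \<in> less_pairs \<Longrightarrow> (l, k) \<notin> less_pairs"
  by (simp add: less_pairs_def)

lemma sum_pairs:
  fixes f :: "'d::finite \<Rightarrow> 'd \<Rightarrow> real"
  shows "(\<Sum>k\<in>UNIV. \<Sum>l\<in>UNIV. f k l) =
    (\<Sum>(k, l)\<in>less_pairs. f k l + f l k) + (\<Sum>k\<in>UNIV. f k k)"
proof -
  have fin: "finite (A :: ('d \<times> 'd) set)" for A by simp
  have "(\<Sum>k\<in>UNIV. \<Sum>l\<in>UNIV. f k l) = (\<Sum>(k, l)\<in>UNIV. f k l)"
    by (simp add: sum.cartesian_product)
  also have "\<dots> = (\<Sum>(k, l)\<in>less_pairs \<union> prod.swap ` less_pairs. f k l) + (\<Sum>(k, l)\<in>range (\<lambda>k. (k, k)). f k l)"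
    by (subst pairs_trichotomy, rule sum.union_disjoint[OF fin fin]) auto
  also have "(\<Sum>(k, l)\<in>less_pairs \<union> prod.swap ` less_pairs. f k l) =
      (\<Sum>(k, l)\<in>less_pairs. f k l) + (\<Sum>(k, l)\<in>prod.swap ` less_pairs. f k l)"
    by (rule sum.union_disjoint[OF fin fin]) (auto dest: less_pairs_asym)
  also have "(\<Sum>(k, l)\<in>prod.swap ` less_pairs. f k l) = (\<Sum>(k, l)\<in>less_pairs. f l k)"
    by (subst sum.reindex) (auto intro!: sum.cong inj_onI)
  also have "(\<Sum>(k, l)\<in>range (\<lambda>k. (k, k)). f k l) = (\<Sum>k\<in>UNIV. f k k)"
    by (subst sum.reindex) (auto intro!: inj_onI)
  finally show ?thesis by (simp add: sum.distrib case_prod_unfold)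
qed

lemma matrix_vector_inner: "(B *v q) \<bullet> w = (\<Sum>k\<in>UNIV. \<Sum>l\<in>UNIV. B $ k $ l * q $ l * w $ k)"
  for B :: "real ^ 'd ^ 'd"
  by (simp add: inner_vec_def matrix_vector_mult_def sum_distrib_right)

text \<open>The coefficients are, up to sign, the coordinates of the exterior product of
  \<open>q\<close> and \<open>w\<close>, that is, the 2 by 2 minors.\<close>

lemma skew_inner:
  fixes B :: "real ^ 'd ^ 'd"
  assumes "transpose B = - B"
  shows "(B *v q) \<bullet> w = (\<Sum>(k, l)\<in>less_pairs. B $ k $ l * (q $ l * w $ k - q $ k * w $ l))"
proof -
  have skew: "B $ l $ k = - B $ k $ l" for k l
  proof -
    have "transpose B $ k $ l = (- B) $ k $ l" using assms by simp
    then show ?thesis by (simp add: transpose_def)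
  qed
  have "B $ k $ k = 0" for k using skew[of k k] by simp
  then have "(\<Sum>k\<in>UNIV. B $ k $ k * q $ k * w $ k) = 0" by simp
  moreover have "(\<Sum>(k, l)\<in>less_pairs. B $ k $ l * q $ l * w $ k + B $ l $ k * q $ k * w $ l) =
      (\<Sum>(k, l)\<in>less_pairs. B $ k $ l * (q $ l * w $ k - q $ k * w $ l))"
  proof (rule sum.cong[OF refl], clarify)
    fix k l
    show "B $ k $ l * q $ l * w $ k + B $ l $ k * q $ k * w $ l =
        B $ k $ l * (q $ l * w $ k - q $ k * w $ l)"
      unfolding skew[of k l] by (simp add: algebra_simps)
  qed
  ultimately show ?thesis unfolding matrix_vector_inner sum_pairs by simp
qed

lemma skew_inner_self: "transpose B = - B \<Longrightarrow> (B *v w) \<bullet> w = 0" for B :: "real ^ 'd ^ 'd"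
  by (simp add: skew_inner mult.commute)

section \<open>The position part and the rotation part of a row\<close>

definition skew_motions :: "'v set \<Rightarrow> (('v \<Rightarrow> real ^ 'd::finite) \<times> ('v \<Rightarrow> (real ^ 'd) ^ 'd) \<times> ((real ^ 'd) ^ 'd)) set" where
  "skew_motions V = {(p, A, L). \<forall>u\<in>V. transpose (A u) = - A u}"

definition position_row where
  "position_row s t w e = (\<lambda>(p, A, L). (p (t e) - p (s e)) \<bullet> w e)"

definition rotation_row where
  "rotation_row s t qs qt c w e =
     (\<lambda>(p, A, L). (L *v c e + A (t e) *v qt e - A (s e) *v qs e) \<bullet> w e)"

lemma sum_delta_diff:
  fixes g :: "'v \<Rightarrow> real"
  assumes "finite S" "r \<in> S" "a \<in> S"
  shows "(\<Sum>u\<in>S-{r}. of_bool (a = u) * (g u - g r)) = g a - g r"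
proof -
  have "(\<Sum>u\<in>S-{r}. of_bool (a = u) * (g u - g r)) = (\<Sum>u\<in>S-{r}. if a = u then g u - g r else 0)"
    by (intro sum.cong) auto
  then show ?thesis using assms by (simp add: sum.delta)
qed

text \<open>Rows supported on \<open>S\<close> see positions only relative to one vertex
  \<open>r\<close> of \<open>S\<close>, so they are combinations of the coordinates of
  \<open>p u - p r\<close> with \<open>u\<close> in \<open>S\<close> other than
  \<open>r\<close>.\<close>

lemma card_position_rows:
  fixes w :: "'e \<Rightarrow> real ^ 'd::finite" and M :: "(('v \<Rightarrow> real ^ 'd) \<times> 'a \<times> 'b) set"
  assumes ind: "lin_indep_on M (position_row s t w) F" and "finite F"
    and S: "finite S" "S \<noteq> {}" and F: "\<And>e. e \<in> F \<Longrightarrow> s e \<in> S \<and> t e \<in> S"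
  shows "card F + CARD('d) \<le> CARD('d) * card S"
proof -
  obtain r where r: "r \<in> S" using S by blast
  let ?K = "(S - {r}) \<times> (UNIV :: 'd set)"
  have "card F \<le> card ?K"
  proof (rule lin_indep_on_card_le[OF ind])
    fix e and x :: "('v \<Rightarrow> real ^ 'd) \<times> 'a \<times> 'b" assume e: "e \<in> F"
    obtain p A L where x: "x = (p, A, L)" by (cases x)
    have "(\<Sum>(u, k)\<in>?K. (of_bool (t e = u) - of_bool (s e = u)) * w e $ k * (p u $ k - p r $ k)) =
        (\<Sum>k\<in>UNIV. w e $ k * ((\<Sum>u\<in>S-{r}. of_bool (t e = u) * (p u $ k - p r $ k)) -
            (\<Sum>u\<in>S-{r}. of_bool (s e = u) * (p u $ k - p r $ k))))"
      unfolding sum.cartesian_product[symmetric]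
      by (subst sum.swap) (simp add: sum_distrib_left sum_subtractf[symmetric] algebra_simps)
    also have "\<dots> = (\<Sum>k\<in>UNIV. w e $ k * (p (t e) $ k - p (s e) $ k))"
      using F[OF e] S r sum_delta_diff[of S r "t e" "\<lambda>u. p u $ _"] sum_delta_diff[of S r "s e" "\<lambda>u. p u $ _"]
      by (simp add: sum_delta_diff[of S r _ "\<lambda>u. p u $ _"])
    finally show "position_row s t w e x = (\<Sum>y\<in>?K.
        (of_bool (t e = fst y) - of_bool (s e = fst y)) * w e $ snd y *
        (\<lambda>(p, A, L). p (fst y) $ snd y - p r $ snd y) x)"
      by (simp add: x position_row_def inner_vec_def case_prod_unfold mult.commute)
  qed (use assms in auto)
  also have "\<dots> = (card S - 1) * CARD('d)"
    using S r by (simp add: card_cartesian_product)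
  finally show ?thesis using S by (cases "card S") (auto simp: algebra_simps)
qed

text \<open>Subtracting the infinitesimal rotation \<open>A r\<close> of the whole framework, which changes \<open>L\<close> by
  \<open>A r ** \<Lambda>\<close>, makes the frame of \<open>r \<in> S\<close> motionless.\<close>

lemma card_rotation_rows:
  fixes w :: "'e \<Rightarrow> real ^ 'd::finite" and V :: "'v set"
  assumes ind: "lin_indep_on (skew_motions V) (rotation_row s t qs qt c w) F" and "finite F"
    and S: "finite S" "S \<noteq> {}" "S \<subseteq> V" and F: "\<And>e. e \<in> F \<Longrightarrow> s e \<in> S \<and> t e \<in> S"
    and w: "\<And>e. e \<in> F \<Longrightarrow> w e = \<Lambda> *v c e + qt e - qs e"
  shows "card F \<le> (CARD('d) choose 2) * (card S - 1) + CARD('d)\<^sup>2"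
proof -
  obtain r where r: "r \<in> S" using S by blast
  let ?K1 = "(S - {r}) \<times> (less_pairs :: ('d \<times> 'd) set)" and ?K2 = "UNIV :: ('d \<times> 'd) set"
  \<comment> \<open>The functions \<open>g\<close> are the upper entries of \<open>A u - A r\<close>
    and all entries of \<open>L - A r ** \<Lambda>\<close>; \<open>a\<close> holds the coefficients
    of the row of \<open>e\<close> with respect to them.\<close>
  define a where "a e = case_sum
      (\<lambda>(u, k, l). of_bool (t e = u) * (qt e $ l * w e $ k - qt e $ k * w e $ l)
                 - of_bool (s e = u) * (qs e $ l * w e $ k - qs e $ k * w e $ l))
      (\<lambda>(k, l). c e $ l * w e $ k)" for e
  define g where "g = case_sum
      (\<lambda>(u, k, l). \<lambda>(p :: 'v \<Rightarrow> real ^ 'd, A, L :: real ^ 'd ^ 'd). A u $ k $ l - A r $ k $ l)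
      (\<lambda>(k, l). \<lambda>(p, A, L). (L - A r ** \<Lambda>) $ k $ l)"
  have "card F \<le> card (?K1 <+> ?K2)"
  proof (rule lin_indep_on_card_le[OF ind])
    fix e and x :: "('v \<Rightarrow> real ^ 'd) \<times> ('v \<Rightarrow> (real ^ 'd) ^ 'd) \<times> ((real ^ 'd) ^ 'd)"
    assume e: "e \<in> F" and xM: "x \<in> skew_motions V"
    obtain p A L where x: "x = (p, A, L)" by (cases x)
    have skew: "transpose (A u - A r) = - (A u - A r)" if "u \<in> S" for u
    proof -
      have "transpose (A u - A r) = transpose (A u) - transpose (A r)"
        by (simp add: transpose_def vec_eq_iff)
      then show ?thesis using xM that S r by (auto simp: skew_motions_def x subset_iff)
    qed
    \<comment> \<open>A rotation moves a bar orthogonally to itself. The terms with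
      \<open>A r\<close> add up to exactly this expression, because \<open>w e\<close> is
      \<open>\<Lambda> *v c e + qt e - qs e\<close>.\<close>
    have skew_r: "(A r *v w e) \<bullet> w e = 0"
      using xM S r by (intro skew_inner_self) (auto simp: skew_motions_def x)
    have one: "(\<Sum>(u, k, l)\<in>?K1. of_bool (y = u) * (q $ l * w e $ k - q $ k * w e $ l) * (A u $ k $ l - A r $ k $ l))
        = ((A y - A r) *v q) \<bullet> w e" if y: "y \<in> S" for y q
    proof -
      have "(\<Sum>(u, k, l)\<in>?K1. of_bool (y = u) * (q $ l * w e $ k - q $ k * w e $ l) * (A u $ k $ l - A r $ k $ l))
        = (\<Sum>u\<in>S-{r}. \<Sum>kl\<in>less_pairs. of_bool (y = u) *
            (q $ snd kl * w e $ fst kl - q $ fst kl * w e $ snd kl) * (A u $ fst kl $ snd kl - A r $ fst kl $ snd kl))"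
        by (simp add: sum.cartesian_product case_prod_unfold)
      also have "\<dots> = (\<Sum>kl\<in>less_pairs. \<Sum>u\<in>S-{r}. of_bool (y = u) *
            (q $ snd kl * w e $ fst kl - q $ fst kl * w e $ snd kl) * (A u $ fst kl $ snd kl - A r $ fst kl $ snd kl))"
        by (rule sum.swap)
      also have "\<dots> = (\<Sum>kl\<in>less_pairs. (q $ snd kl * w e $ fst kl - q $ fst kl * w e $ snd kl) *
            (\<Sum>u\<in>S-{r}. of_bool (y = u) * (A u $ fst kl $ snd kl - A r $ fst kl $ snd kl)))"
        by (simp add: sum_distrib_left mult_ac)
      also have "\<dots> = (\<Sum>kl\<in>less_pairs. (q $ snd kl * w e $ fst kl - q $ fst kl * w e $ snd kl) *
            (A y $ fst kl $ snd kl - A r $ fst kl $ snd kl))"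
      proof (rule sum.cong[OF refl])
        fix kl :: "'d \<times> 'd"
        show "(q $ snd kl * w e $ fst kl - q $ fst kl * w e $ snd kl) *
            (\<Sum>u\<in>S-{r}. of_bool (y = u) * (A u $ fst kl $ snd kl - A r $ fst kl $ snd kl)) =
            (q $ snd kl * w e $ fst kl - q $ fst kl * w e $ snd kl) *
            (A y $ fst kl $ snd kl - A r $ fst kl $ snd kl)"
          by (subst sum_delta_diff[OF S(1) r y, of "\<lambda>u. A u $ fst kl $ snd kl"]) simp
      qed
      also have "\<dots> = ((A y - A r) *v q) \<bullet> w e"
        unfolding skew_inner[OF skew[OF y]] by (intro sum.cong) (auto simp: algebra_simps)
      finally show ?thesis .
    qed
    have "(\<Sum>k\<in>?K1 <+> ?K2. a e k * g k x) = (\<Sum>k\<in>?K1. a e (Inl k) * g (Inl k) x) + (\<Sum>k\<in>?K2. a e (Inr k) * g (Inr k) x)"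
      using S by (subst sum.Plus) auto
    also have "(\<Sum>k\<in>?K1. a e (Inl k) * g (Inl k) x) =
        (\<Sum>(u, k, l)\<in>?K1. of_bool (t e = u) * (qt e $ l * w e $ k - qt e $ k * w e $ l) * (A u $ k $ l - A r $ k $ l)) -
        (\<Sum>(u, k, l)\<in>?K1. of_bool (s e = u) * (qs e $ l * w e $ k - qs e $ k * w e $ l) * (A u $ k $ l - A r $ k $ l))"
      by (simp add: a_def g_def x sum_subtractf[symmetric] case_prod_unfold algebra_simps)
    also have "\<dots> = ((A (t e) - A r) *v qt e) \<bullet> w e - ((A (s e) - A r) *v qs e) \<bullet> w e"
      using F[OF e] by (simp only: one)
    also have "(\<Sum>k\<in>?K2. a e (Inr k) * g (Inr k) x) = ((L - A r ** \<Lambda>) *v c e) \<bullet> w e"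
      by (simp add: a_def g_def x matrix_vector_inner sum.cartesian_product case_prod_unfold mult_ac)
    also have "((A (t e) - A r) *v qt e) \<bullet> w e - ((A (s e) - A r) *v qs e) \<bullet> w e + ((L - A r ** \<Lambda>) *v c e) \<bullet> w e
        = (L *v c e + A (t e) *v qt e - A (s e) *v qs e) \<bullet> w e - (A r *v (\<Lambda> *v c e + qt e - qs e)) \<bullet> w e"
      by (simp add: matrix_vector_mult_diff_rdistrib matrix_vector_mult_diff_distrib matrix_vector_right_distrib
          inner_diff_left inner_add_left matrix_vector_mul_assoc)
    also have "\<dots> = rotation_row s t qs qt c w e x"
      unfolding w[OF e, symmetric] skew_r by (simp add: rotation_row_def x)
    finally show "rotation_row s t qs qt c w e x = (\<Sum>k\<in>?K1 <+> ?K2. a e k * g k x)" by simp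
  qed (use assms in auto)
  also have "\<dots> = (CARD('d) choose 2) * (card S - 1) + CARD('d)\<^sup>2"
    using S r by (simp add: card_Plus card_cartesian_product card_less_pairs power2_eq_square)
  finally show ?thesis .
qed

text \<open>Splitting the rows gives two classes that satisfy the sparsity bounds. On the full
  vertex set the two bounds add up to the number of edges, so both are attained and both classes are
  tight.\<close>

lemma decomposition_from_independent_rows:
  fixes w :: "'e \<Rightarrow> real ^ 'd::finite" and Q :: "('v, 'e) multigraph"
  assumes Q: "finite_multigraph Q" and n: "card (verts Q) \<ge> 1"
    and m: "card (edges Q) = ((CARD('d) + 1) choose 2) * (card (verts Q) - 1) + CARD('d)\<^sup>2"
    and ends: "\<And>e. e \<in> edges Q \<Longrightarrow> ends Q e = {s e, t e}"
    and w: "\<And>e. e \<in> edges Q \<Longrightarrow> w e = \<Lambda> *v c e + qt e - qs e"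
    and ind: "lin_indep_on (skew_motions (verts Q))
      (\<lambda>e (p, A, L). (L *v c e + A (t e) *v qt e - A (s e) *v qs e + p (t e) - p (s e)) \<bullet> w e) (edges Q)"
  shows "sparse_decomposition CARD('d) Q"
proof -
  let ?d = "CARD('d)" and ?n = "card (verts Q)"
  have finV: "finite (verts Q)" and finE: "finite (edges Q)" using Q by (auto simp: finite_multigraph_def)
  obtain E1 E2 where E: "E1 \<inter> E2 = {}" "E1 \<union> E2 = edges Q"
    and i1: "lin_indep_on (skew_motions (verts Q)) (position_row s t w) E1"
    and i2: "lin_indep_on (skew_motions (verts Q)) (rotation_row s t qs qt c w) E2"
    using lin_indep_on_split[OF ind finE, of "position_row s t w" "rotation_row s t qs qt c w"]
    by (force simp: position_row_def rotation_row_def algebra_simps)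
  have fin: "finite E1" "finite E2" using E finE by (metis finite_Un)+
  have ends1: "ends Q e = {s e, t e}" if "e \<in> E1" for e using ends[of e] E that by blast
  have ends2: "ends Q e = {s e, t e}" "w e = \<Lambda> *v c e + qt e - qs e" if "e \<in> E2" for e
    using ends[of e] w[of e] E that by blast+
  note ch = choose_two_identities(1)[of ?d] and dd = choose_two_identities(2)
  have sp1: "int (card {e \<in> E1. ends Q e \<subseteq> S}) \<le> int ?d * int (card S) + - int ?d"
    if S: "S \<subseteq> verts Q" "S \<noteq> {}" for S
  proof -
    have "card {e \<in> E1. ends Q e \<subseteq> S} + ?d \<le> ?d * card S"
      using fin S ends1 finite_subset[OF S(1) finV]
      by (intro card_position_rows[OF lin_indep_on_subset[OF i1]]) auto
    then show ?thesis by (simp flip: of_nat_mult)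
  qed
  have sp2: "int (card {e \<in> E2. ends Q e \<subseteq> S}) \<le> int (?d choose 2) * int (card S) + int ((?d + 1) choose 2)"
    if S: "S \<subseteq> verts Q" "S \<noteq> {}" for S
  proof -
    have finS: "finite S" using finite_subset[OF S(1) finV] .
    have "card {e \<in> E2. ends Q e \<subseteq> S} \<le> (?d choose 2) * (card S - 1) + ?d\<^sup>2"
      using fin S ends2 finS
      by (intro card_rotation_rows[OF lin_indep_on_subset[OF i2], where \<Lambda> = \<Lambda>]) auto
    moreover obtain k where "card S = Suc k" using finS S by (cases "card S") auto
    ultimately have "card {e \<in> E2. ends Q e \<subseteq> S} \<le> (?d choose 2) * card S + ((?d + 1) choose 2)"
      unfolding ch dd[of ?d, symmetric] by simp
    then show ?thesis by (simp flip: of_nat_mult of_nat_add)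
  qed
  have "{e \<in> E1. ends Q e \<subseteq> verts Q} = E1" "{e \<in> E2. ends Q e \<subseteq> verts Q} = E2" "verts Q \<noteq> {}"
    using E Q n by (auto simp: finite_multigraph_def is_multigraph_def)
  then have up: "int (card E1) \<le> int ?d * int ?n + - int ?d"
    "int (card E2) \<le> int (?d choose 2) * int ?n + int ((?d + 1) choose 2)"
    using sp1[of "verts Q"] sp2[of "verts Q"] by auto
  obtain k where k: "?n = Suc k" using n by (cases ?n) auto
  have "int (card E1) + int (card E2) = int (card (edges Q))"
    using E fin card_Un_disjoint[of E1 E2] by (metis of_nat_add)
  also have "\<dots> = int ((?d choose 2) + ?d) * int k + (int ?d + 2 * int (?d choose 2))"
    unfolding m k ch dd[of ?d, symmetric] by simp
  finally have "int (card E1) = int ?d * int ?n + - int ?d"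
    "int (card E2) = int (?d choose 2) * int ?n + int ((?d + 1) choose 2)"
    using up unfolding k ch by (simp_all add: algebra_simps)
  then show ?thesis
    using E sp1 sp2 unfolding sparse_decomposition_def tight_def sparsity_type_def spanning_subgraph_def
    by (intro exI[of _ E1] exI[of _ E2]) auto
qed

section \<open>Rigid frameworks decompose\<close>

lemma lookup_scaleR:
  "Poly_Mapping.lookup (r *\<^sub>R x) i = r *\<^sub>R Poly_Mapping.lookup x i"
  for x :: "'k \<Rightarrow>\<^sub>0 'a::real_vector"
proof -
  have "finite {i. r *\<^sub>R Poly_Mapping.lookup x i \<noteq> 0}"
    by (rule finite_subset[of _ "Poly_Mapping.keys x"]) (auto simp: in_keys_iff)
  then show ?thesis by (simp add: scaleR_poly_mapping_def)
qed

lemma lookup_sum_single: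
  assumes "finite E" "e \<in> E"
  shows "Poly_Mapping.lookup (\<Sum>f\<in>E. Poly_Mapping.single f (x f)) e = x e"
proof -
  have "Poly_Mapping.lookup (\<Sum>f\<in>E. Poly_Mapping.single f (x f)) e = (\<Sum>f\<in>E. if f = e then x e else 0)"
    unfolding lookup_sum by (intro sum.cong) (auto simp: lookup_single)
  then show ?thesis using assms by simp
qed

lemma single_eq_scaleR: "Poly_Mapping.single e (x::real) = x *\<^sub>R Poly_Mapping.single e 1"
  by (rule poly_mapping_eqI) (simp add: lookup_scaleR lookup_single when_def)

text \<open>A set of full dimension spans every unit vector. A linear relation valid on the set
  extends to its span, and evaluated at a unit vector it returns one coefficient.\<close>

lemma full_dim_imp_no_relation:
  fixes I :: "('k \<Rightarrow>\<^sub>0 real) set"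
  assumes fin: "finite E" and I: "I \<subseteq> range (\<lambda>x. \<Sum>e\<in>E. Poly_Mapping.single e (x e))"
    and dim: "dim I = card E" and l: "\<And>y. y \<in> I \<Longrightarrow> (\<Sum>e\<in>E. l e * Poly_Mapping.lookup y e) = 0"
    and e: "e \<in> E"
  shows "l e = 0"
proof -
  let ?T = "(\<lambda>e. Poly_Mapping.single e (1::real)) ` E"
  have cT: "card ?T = card E"
    by (intro card_image inj_onI) (metis lookup_single_eq lookup_single_not_eq zero_neq_one)
  have "y \<in> span ?T" if y: "y \<in> I" for y
  proof -
    obtain x where "y = (\<Sum>e\<in>E. Poly_Mapping.single e (x e))" using I y by blast
    then have "y = (\<Sum>e\<in>E. x e *\<^sub>R Poly_Mapping.single e 1)" by (simp flip: single_eq_scaleR)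
    then show ?thesis by (simp only:) (intro span_sum span_scale span_base imageI)
  qed
  moreover obtain B where B: "B \<subseteq> I" "independent B" "card B = dim I"
    using basis_exists[of I] by metis
  ultimately have BT: "B \<subseteq> span ?T" by blast
  have finT: "finite ?T" using fin by simp
  have finB: "finite B" using independent_span_bound[OF finT B(2) BT] by simp
  \<comment> \<open>\<open>B\<close> and \<open>?T\<close> have the same size, so a unit vector
    outside the span of \<open>B\<close> would extend \<open>B\<close> to an independent set larger
    than the spanning set \<open>?T\<close>.\<close>
  have "?T \<subseteq> span B"
  proof (rule ccontr)
    assume "\<not> ?T \<subseteq> span B"
    then obtain x where x: "x \<in> ?T" "x \<notin> span B" by blast
    then have "independent (insert x B)" using B(2) by (simp add: independent_insert)
    then have "card (insert x B) \<le> card ?T"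
      using independent_span_bound[OF finT, of "insert x B"] BT x(1) span_base[OF x(1)] by blast
    moreover have "x \<notin> B" using x(2) span_base by blast
    ultimately show False using finB B(3) dim cT by simp
  qed
  then have single: "Poly_Mapping.single e 1 \<in> span B" using e by blast
  have sub: "subspace {y. (\<Sum>e\<in>E. l e * Poly_Mapping.lookup y e) = 0}"
  proof (rule subspaceI)
    fix c :: real and x :: "'k \<Rightarrow>\<^sub>0 real"
    have "(\<Sum>e\<in>E. l e * Poly_Mapping.lookup (c *\<^sub>R x) e) = c * (\<Sum>e\<in>E. l e * Poly_Mapping.lookup x e)"
      unfolding lookup_scaleR sum_distrib_left by (intro sum.cong) auto
    then show "x \<in> {y. (\<Sum>e\<in>E. l e * Poly_Mapping.lookup y e) = 0} \<Longrightarrow>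
        c *\<^sub>R x \<in> {y. (\<Sum>e\<in>E. l e * Poly_Mapping.lookup y e) = 0}" by simp
  qed (auto simp: lookup_add distrib_left sum.distrib)
  have "span B \<subseteq> {y. (\<Sum>e\<in>E. l e * Poly_Mapping.lookup y e) = 0}"
    using B(1) l by (intro span_minimal[OF _ sub]) auto
  then have "(\<Sum>f\<in>E. l f * Poly_Mapping.lookup (Poly_Mapping.single e 1) f) = 0" using single by blast
  moreover have "(\<Sum>f\<in>E. l f * Poly_Mapping.lookup (Poly_Mapping.single e 1) f) = (\<Sum>f\<in>E. if f = e then l e else 0)"
    by (intro sum.cong) (auto simp: lookup_single)
  ultimately show ?thesis using fin e by simp
qed

section \<open>Orbits of the period group\<close>

lemma graph_aut_mult:
  assumes "\<gamma> \<in> carrier (graph_aut G)" "\<delta> \<in> carrier (graph_aut G)"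
  shows "\<gamma> \<otimes>\<^bsub>graph_aut G\<^esub> \<delta> = (compose (verts G) (fst \<gamma>) (fst \<delta>), compose (edges G) (snd \<gamma>) (snd \<delta>))"
  using assms by (cases \<gamma>; cases \<delta>) (auto simp: graph_aut_def BijGroup_def)

lemma carrier_graph_autD:
  assumes "\<gamma> \<in> carrier (graph_aut G)"
  shows "bij_betw (fst \<gamma>) (verts G) (verts G)" "bij_betw (snd \<gamma>) (edges G) (edges G)"
    and "\<And>e. e \<in> edges G \<Longrightarrow> ends G (snd \<gamma> e) = fst \<gamma> ` ends G e"
    and "fst \<gamma> \<in> extensional (verts G)" "snd \<gamma> \<in> extensional (edges G)"
  using assms by (auto simp: graph_aut_def Bij_def)

text \<open>The group is parametrised by integer vectors, so orbits are ranges and computing in them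
  is addition. Both directions use this locale: for a given rigid framework and for the constructed
  covering graph.\<close>

locale period_action =
  fixes G :: "('a, 'b) multigraph" and \<Gamma> :: "('a, 'b) graph_perm set"
    and h :: "('d \<Rightarrow>\<^sub>0 int) \<Rightarrow> ('a, 'b) graph_perm"
  assumes multigraph: "is_multigraph G"
    and subset: "\<Gamma> \<subseteq> carrier (graph_aut G)"
    and iso: "h \<in> iso (free_Abelian_group UNIV) (aut_subgroup G \<Gamma>)"
begin

lemma range_h: "range h = \<Gamma>"
proof -
  have "carrier (free_Abelian_group (UNIV :: 'd set)) = UNIV" by auto
  then show ?thesis using iso by (auto simp: iso_def bij_betw_def)
qed

lemma h_add: "h (a + b) = h a \<otimes>\<^bsub>graph_aut G\<^esub> h b"
  using iso by (auto simp: iso_def hom_def)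

lemma h_carrier: "h a \<in> carrier (graph_aut G)"
  using range_h subset by blast

lemmas h_bij = carrier_graph_autD(1,2)[OF h_carrier]
lemmas h_ends = carrier_graph_autD(3)[OF h_carrier]

lemma fst_h_add: "u \<in> verts G \<Longrightarrow> fst (h (a + b)) u = fst (h a) (fst (h b) u)"
  and snd_h_add: "e \<in> edges G \<Longrightarrow> snd (h (a + b)) e = snd (h a) (snd (h b) e)"
  unfolding h_add by (simp_all add: graph_aut_mult[OF h_carrier h_carrier] compose_def)

lemma h_mem: "u \<in> verts G \<Longrightarrow> fst (h a) u \<in> verts G" "e \<in> edges G \<Longrightarrow> snd (h a) e \<in> edges G"
  using h_bij[of a] by (auto simp: bij_betw_def)

text \<open>By additivity \<open>h 0\<close> acts idempotently, and an injective idempotent map is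
  the identity.\<close>

lemma fst_h_0: "u \<in> verts G \<Longrightarrow> fst (h 0) u = u"
  using fst_h_add[of u 0 0] h_bij(1)[of 0] h_mem(1)[of u 0] by (auto simp: bij_betw_def inj_on_def)

lemma snd_h_0: "e \<in> edges G \<Longrightarrow> snd (h 0) e = e"
  using snd_h_add[of e 0 0] h_bij(2)[of 0] h_mem(2)[of e 0] by (auto simp: bij_betw_def inj_on_def)

abbreviation "vorbit \<equiv> orbit (aut_subgroup G \<Gamma>) fst"
abbreviation "eorbit \<equiv> orbit (aut_subgroup G \<Gamma>) snd"

lemma vorbit_eq: "vorbit u = range (\<lambda>a. fst (h a) u)"
  and eorbit_eq: "eorbit e = range (\<lambda>a. snd (h a) e)"
proof -
  have "vorbit u = (\<lambda>g. fst g u) ` \<Gamma>" "eorbit e = (\<lambda>g. snd g e) ` \<Gamma>"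
    by (force simp: orbit_def)+
  then show "vorbit u = range (\<lambda>a. fst (h a) u)" "eorbit e = range (\<lambda>a. snd (h a) e)"
    by (simp_all add: range_h[symmetric] image_image)
qed

lemma vorbit_self: "u \<in> verts G \<Longrightarrow> u \<in> vorbit u"
  unfolding vorbit_eq using fst_h_0 by (metis rangeI)

lemma eorbit_self: "e \<in> edges G \<Longrightarrow> e \<in> eorbit e"
  unfolding eorbit_eq using snd_h_0 by (metis rangeI)

lemma vorbit_translate:
  assumes "u \<in> verts G" shows "vorbit (fst (h a) u) = vorbit u"
proof -
  have "vorbit (fst (h a) u) = range (\<lambda>b. fst (h (b + a)) u)"
    by (simp add: vorbit_eq fst_h_add[OF assms])
  also have "\<dots> = (\<lambda>b. fst (h b) u) ` range (\<lambda>b. b + a)"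
    by (simp only: image_image)
  also have "range (\<lambda>b. b + a) = UNIV"
    by (rule surjI[of _ "\<lambda>b. b - a"]) simp
  finally show ?thesis by (simp add: vorbit_eq)
qed

lemma eorbit_translate:
  assumes "e \<in> edges G" shows "eorbit (snd (h a) e) = eorbit e"
proof -
  have "eorbit (snd (h a) e) = range (\<lambda>b. snd (h (b + a)) e)"
    by (simp add: eorbit_eq snd_h_add[OF assms])
  also have "\<dots> = (\<lambda>b. snd (h b) e) ` range (\<lambda>b. b + a)"
    by (simp only: image_image)
  also have "range (\<lambda>b. b + a) = UNIV"
    by (rule surjI[of _ "\<lambda>b. b - a"]) simp
  finally show ?thesis by (simp add: eorbit_eq)
qed

lemma vorbit_mem:
  assumes "X \<in> verts (quotient_graph G \<Gamma>)" and "x \<in> X"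
  shows "x \<in> verts G \<and> X = vorbit x"
proof -
  obtain y where y: "y \<in> verts G" "X = vorbit y"
    using assms(1) by (auto simp: quotient_graph_def orbits_def)
  then obtain a where "x = fst (h a) y" using assms(2) vorbit_eq by auto
  then show ?thesis using y vorbit_translate h_mem by simp
qed

lemma eorbit_mem:
  assumes "X \<in> edges (quotient_graph G \<Gamma>)" and "x \<in> X"
  shows "x \<in> edges G \<and> X = eorbit x"
proof -
  obtain y where y: "y \<in> edges G" "X = eorbit y"
    using assms(1) by (auto simp: quotient_graph_def orbits_def)
  then obtain a where "x = snd (h a) y" using assms(2) eorbit_eq by auto
  then show ?thesis using y eorbit_translate h_mem by simp
qed

lemma vorbit_in_quotient: "u \<in> verts G \<Longrightarrow> vorbit u \<in> verts (quotient_graph G \<Gamma>)"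
  and eorbit_in_quotient: "e \<in> edges G \<Longrightarrow> eorbit e \<in> edges (quotient_graph G \<Gamma>)"
  by (auto simp: quotient_graph_def orbits_def)

lemma ends_quotient:
  assumes e: "e \<in> edges G"
  shows "ends (quotient_graph G \<Gamma>) (eorbit e) = vorbit ` ends G e"
proof -
  have "vorbit ` ends G (snd (h a) e) = vorbit ` ends G e" for a
  proof -
    have "ends G e \<subseteq> verts G" using multigraph e by (auto simp: is_multigraph_def)
    then show ?thesis unfolding h_ends[OF e] image_image
      by (intro image_cong refl vorbit_translate) auto
  qed
  then show ?thesis by (simp add: quotient_graph_def eorbit_eq)
qed

end

locale framework_representatives =
  period_action "graph F" "periods F" "basis_iso R"
  for F :: "('a, 'b, 'd::finite) framework" and R :: "('a, 'b, 'd) representatives" +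
  assumes valid: "valid_representatives F R"
begin

abbreviation "qgraph \<equiv> quotient_graph (graph F) (periods F)"

definition "vrep X = (THE v. v \<in> vreps R \<and> v \<in> X)"
definition "erep X = (THE e. e \<in> ereps R \<and> e \<in> X)"

lemma vrep: "X \<in> verts qgraph \<Longrightarrow> vrep X \<in> vreps R \<and> vrep X \<in> X"
  unfolding vrep_def using valid
  by (intro theI'[of "\<lambda>v. v \<in> vreps R \<and> v \<in> X"]) (auto simp: valid_representatives_def)

lemma erep: "X \<in> edges qgraph \<Longrightarrow> erep X \<in> ereps R \<and> erep X \<in> X"
  unfolding erep_def using valid
  by (intro theI'[of "\<lambda>e. e \<in> ereps R \<and> e \<in> X"]) (auto simp: valid_representatives_def)

lemma vrep_unique: "X \<in> verts qgraph \<Longrightarrow> v \<in> vreps R \<Longrightarrow> v \<in> X \<Longrightarrow> vrep X = v"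
  using valid vrep[of X] by (auto simp: valid_representatives_def)

lemma erep_unique: "X \<in> edges qgraph \<Longrightarrow> e \<in> ereps R \<Longrightarrow> e \<in> X \<Longrightarrow> erep X = e"
  using valid erep[of X] by (auto simp: valid_representatives_def)

lemma reps_subset: "vreps R \<subseteq> verts (graph F)" "ereps R \<subseteq> edges (graph F)"
  using valid by (auto simp: valid_representatives_def)

lemma bij_vrep: "bij_betw vrep (verts qgraph) (vreps R)"
proof (rule bij_betwI[where g = vorbit])
  show "vorbit \<in> vreps R \<rightarrow> verts qgraph" using reps_subset vorbit_in_quotient by auto
  show "vorbit (vrep X) = X" if "X \<in> verts qgraph" for X
    using vrep[OF that] vorbit_mem[OF that] by auto
  show "vrep (vorbit v) = v" if "v \<in> vreps R" for v
    using that reps_subset vorbit_in_quotient vorbit_self by (intro vrep_unique) auto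
qed (use vrep in auto)

lemma bij_erep: "bij_betw erep (edges qgraph) (ereps R)"
proof (rule bij_betwI[where g = eorbit])
  show "eorbit \<in> ereps R \<rightarrow> edges qgraph" using reps_subset eorbit_in_quotient by auto
  show "eorbit (erep X) = X" if "X \<in> edges qgraph" for X
    using erep[OF that] eorbit_mem[OF that] by auto
  show "erep (eorbit e) = e" if "e \<in> ereps R" for e
    using that reps_subset eorbit_in_quotient eorbit_self by (intro erep_unique) auto
qed (use erep in auto)

lemma erep_ends:
  assumes "e \<in> ereps R"
  shows "src R e \<in> vreps R" "tgt R e \<in> vreps R"
    and "ends qgraph (eorbit e) = {vorbit (src R e), vorbit (tgt R e)}"
proof -
  have e: "src R e \<in> vreps R" "tgt R e \<in> vreps R" "ends (graph F) e = {src R e, far_end R e}"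
    using valid assms by (auto simp: valid_representatives_def)
  then show "src R e \<in> vreps R" "tgt R e \<in> vreps R" by auto
  have "vorbit (far_end R e) = vorbit (tgt R e)"
    unfolding far_end_def using e reps_subset by (intro vorbit_translate) auto
  then show "ends qgraph (eorbit e) = {vorbit (src R e), vorbit (tgt R e)}"
    using ends_quotient[of e] assms reps_subset e by auto
qed

text \<open>The isomorphism followed by the choice of representatives identifies \<open>Q\<close>
  with the representatives, vertices by \<open>\<rho>\<close> and edges by \<open>r\<close>. The
  rank equals the number of rows, so a relation between the rows over \<open>Q\<close>, carried over
  by \<open>r\<close>, must be trivial.\<close>

lemma decomposition_if_rank:
  fixes Q :: "('v, 'e) multigraph"
  assumes Q: "finite_multigraph Q" and n: "card (verts Q) \<ge> 1"
    and m: "card (edges Q) = ((CARD('d) + 1) choose 2) * (card (verts Q) - 1) + (CARD('d))\<^sup>2"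
    and rank: "rigidity_rank F R = card (edges Q)" and iso: "multigraph_iso Q qgraph"
  shows "sparse_decomposition CARD('d) Q"
proof -
  obtain f g where f: "bij_betw f (verts Q) (verts qgraph)" and g: "bij_betw g (edges Q) (edges qgraph)"
    and fg: "\<And>e. e \<in> edges Q \<Longrightarrow> ends qgraph (g e) = f ` ends Q e"
    using iso by (auto simp: multigraph_iso_def)
  define r where "r = erep \<circ> g"
  define \<rho> where "\<rho> = vrep \<circ> f"
  have r: "bij_betw r (edges Q) (ereps R)" unfolding r_def using bij_betw_trans[OF g bij_erep] .
  have \<rho>: "bij_betw \<rho> (verts Q) (vreps R)" unfolding \<rho>_def using bij_betw_trans[OF f bij_vrep] .
  have finE: "finite (edges Q)" using Q by (simp add: finite_multigraph_def)
  have finR: "finite (ereps R)" using bij_betw_finite[OF r] finE by simp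
  define s where "s e = inv_into (verts Q) \<rho> (src R (r e))" for e
  define t where "t e = inv_into (verts Q) \<rho> (tgt R (r e))" for e
  have rE: "r e \<in> ereps R" if "e \<in> edges Q" for e using r that by (auto simp: bij_betw_def)
  have inv: "inv_into (verts Q) \<rho> u \<in> verts Q" "\<rho> (inv_into (verts Q) \<rho> u) = u"
      "f (inv_into (verts Q) \<rho> u) = vorbit u" if u: "u \<in> vreps R" for u
  proof -
    let ?i = "inv_into (verts Q) \<rho> u"
    show 1: "?i \<in> verts Q" "\<rho> ?i = u"
      using \<rho> u by (auto simp: bij_betw_def inv_into_into f_inv_into_f)
    have "f ?i \<in> verts qgraph" using f 1(1) by (auto simp: bij_betw_def)
    then show "f ?i = vorbit u" using vrep[of "f ?i"] vorbit_mem[of "f ?i" u] 1(2) by (auto simp: \<rho>_def)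
  qed
  have st: "s e \<in> verts Q" "t e \<in> verts Q" "\<rho> (s e) = src R (r e)" "\<rho> (t e) = tgt R (r e)"
      "f (s e) = vorbit (src R (r e))" "f (t e) = vorbit (tgt R (r e))" if e: "e \<in> edges Q" for e
    unfolding s_def t_def using inv[OF erep_ends(1)[OF rE[OF e]]] inv[OF erep_ends(2)[OF rE[OF e]]] by auto
  have ends: "ends Q e = {s e, t e}" if e: "e \<in> edges Q" for e
  proof -
    have ge: "g e \<in> edges qgraph" using g e by (auto simp: bij_betw_def)
    have "g e = eorbit (r e)" using erep[OF ge] eorbit_mem[OF ge, of "r e"] by (auto simp: r_def)
    then have "f ` ends Q e = f ` {s e, t e}"
      using fg[OF e] erep_ends(3)[OF rE[OF e]] st[OF e] by auto
    moreover have "ends Q e \<subseteq> verts Q" using Q e by (auto simp: finite_multigraph_def is_multigraph_def)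
    ultimately show ?thesis
      using f st(1,2)[OF e] inj_on_image_eq_iff[of f "verts Q" "ends Q e" "{s e, t e}"] by (auto simp: bij_betw_def)
  qed
  define c where "c e = gain_vec R (r e)" for e
  define qs where "qs e = src_attach F R (r e)" for e
  define qt where "qt e = tgt_attach F R (r e)" for e
  define w where "w e = period_matrix F R *v c e + qt e - qs e" for e
  let ?I = "{(\<Sum>e \<in> ereps R. Poly_Mapping.single e (bar_equation F R p A L e)) | p A L.
            \<forall>v \<in> vreps R. transpose (A v) = - A v}"
  show ?thesis
  proof (rule decomposition_from_independent_rows[OF Q n m ends w_def])
    show "lin_indep_on (skew_motions (verts Q))
      (\<lambda>e (p, A, L). (L *v c e + A (t e) *v qt e - A (s e) *v qs e + p (t e) - p (s e)) \<bullet> w e) (edges Q)"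
      (is "lin_indep_on _ ?row _")
      unfolding lin_indep_on_def
    proof (intro allI impI ballI)
      fix l e0 assume l: "\<forall>x\<in>skew_motions (verts Q). (\<Sum>e\<in>edges Q. l e * ?row e x) = 0" and e0: "e0 \<in> edges Q"
      define l' where "l' e = l (inv_into (edges Q) r e)" for e
      have l'r: "l' (r e) = l e" if "e \<in> edges Q" for e
        using r that by (simp add: l'_def bij_betw_def)
      have "l' (r e0) = 0"
      proof (rule full_dim_imp_no_relation[OF finR, of ?I])
        show "?I \<subseteq> range (\<lambda>x. \<Sum>e\<in>ereps R. Poly_Mapping.single e (x e))" by auto
        show "dim ?I = card (ereps R)"
          using rank bij_betw_same_card[OF r] by (simp add: rigidity_rank_def)
        show "r e0 \<in> ereps R" using rE[OF e0] .
        fix y assume "y \<in> ?I"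
        then obtain p A L where y: "y = (\<Sum>e \<in> ereps R. Poly_Mapping.single e (bar_equation F R p A L e))"
          and skew: "\<forall>v \<in> vreps R. transpose (A v) = - A v" by blast
        have "(\<Sum>e\<in>ereps R. l' e * Poly_Mapping.lookup y e) = (\<Sum>e\<in>ereps R. l' e * bar_equation F R p A L e)"
          using finR by (intro sum.cong refl) (simp add: y lookup_sum_single)
        also have "\<dots> = (\<Sum>e\<in>edges Q. l' (r e) * bar_equation F R p A L (r e))"
          by (rule sum.reindex_bij_betw[OF r, symmetric])
        also have "\<dots> = (\<Sum>e\<in>edges Q. l e * ?row e (p \<circ> \<rho>, A \<circ> \<rho>, L))"
          by (intro sum.cong refl)
             (simp add: l'r st bar_equation_def w_def c_def qs_def qt_def)
        \<comment> \<open>Every motion of the framework pulls back along \<open>\<rho>\<close> to a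
          motion on \<open>Q\<close>, where the relation \<open>l\<close> annihilates it.\<close>
        also have "(p \<circ> \<rho>, A \<circ> \<rho>, L) \<in> skew_motions (verts Q)"
          using skew \<rho> by (auto simp: skew_motions_def bij_betw_def)
        then have "(\<Sum>e\<in>edges Q. l e * ?row e (p \<circ> \<rho>, A \<circ> \<rho>, L)) = 0" using l by blast
        finally show "(\<Sum>e\<in>ereps R. l' e * Poly_Mapping.lookup y e) = 0" .
      qed
      then show "l e0 = 0" using l'r[OF e0] by simp
    qed
  qed
qed

end

lemma rigid_framework_imp_decomposition:
  fixes F :: "('a, 'b, 'd::finite) framework" and Q :: "('v, 'e) multigraph"
  assumes Q: "finite_multigraph Q" and n: "card (verts Q) \<ge> 1"
    and m: "card (edges Q) = ((CARD('d) + 1) choose 2) * (card (verts Q) - 1) + (CARD('d))\<^sup>2"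
    and F: "periodic_framework F" "infinitesimally_rigid F"
    and Q_iso: "multigraph_iso Q (quotient_graph (graph F) (periods F))"
  shows "sparse_decomposition CARD('d) Q"
proof -
  obtain R where R: "valid_representatives F R"
    and rank: "rigidity_rank F R =
          ((CARD('d) + 1) choose 2) * (card (verts (quotient_graph (graph F) (periods F))) - 1) + CARD('d)\<^sup>2"
    using F(2) unfolding infinitesimally_rigid_def by blast
  have "card (verts (quotient_graph (graph F) (periods F))) = card (verts Q)"
    using Q_iso by (auto simp: multigraph_iso_def dest: bij_betw_same_card)
  then have rank: "rigidity_rank F R = card (edges Q)" using rank m by simp
  have pg: "periodic_graph CARD('d) (graph F) (periods F)" using F(1) by (simp add: periodic_framework_def)
  interpret framework_representatives F R
  proof
    show "is_multigraph (graph F)" using pg by (simp add: periodic_graph_def)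
    show "periods F \<subseteq> carrier (graph_aut (graph F))"
      using pg by (auto simp: periodic_graph_def dest: subgroup.subset)
    show "basis_iso R \<in> iso (free_Abelian_group UNIV) (aut_subgroup (graph F) (periods F))"
      using R by (simp add: valid_representatives_def)
    show "valid_representatives F R" by fact
  qed
  show ?thesis by (rule decomposition_if_rank[OF Q n m rank Q_iso])
qed

section \<open>The periodic graph over a gain graph\<close>

text \<open>The monoid laws suffice to identify the inverse of a shift with the opposite shift,
  which is how the shifts are shown to form a subgroup.\<close>

lemma monoid_graph_aut:
  assumes "is_multigraph G"
  shows "monoid (graph_aut G)"
proof (rule monoidI)
  have c: "x \<in> carrier (graph_aut G) \<longleftrightarrow> fst x \<in> Bij (verts G) \<and> snd x \<in> Bij (edges G) \<and>
      (\<forall>e\<in>edges G. ends G (snd x e) = fst x ` ends G e)" for x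
    by (auto simp: graph_aut_def)
  have sub: "ends G e \<subseteq> verts G" if "e \<in> edges G" for e
    using assms that by (auto simp: is_multigraph_def)
  have one: "\<one>\<^bsub>graph_aut G\<^esub> = (\<lambda>x\<in>verts G. x, \<lambda>x\<in>edges G. x)"
    by (simp add: graph_aut_def BijGroup_def)
  show "\<one>\<^bsub>graph_aut G\<^esub> \<in> carrier (graph_aut G)"
    unfolding c one using sub by (auto simp: id_Bij)
  have closed: "x \<otimes>\<^bsub>graph_aut G\<^esub> y \<in> carrier (graph_aut G)"
    if x: "x \<in> carrier (graph_aut G)" and y: "y \<in> carrier (graph_aut G)" for x y
    unfolding graph_aut_mult[OF x y] c
  proof (intro conjI ballI)
    show "fst (compose (verts G) (fst x) (fst y), compose (edges G) (snd x) (snd y)) \<in> Bij (verts G)"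
      "snd (compose (verts G) (fst x) (fst y), compose (edges G) (snd x) (snd y)) \<in> Bij (edges G)"
      using x y by (auto simp: c compose_Bij)
    fix e assume e: "e \<in> edges G"
    then have "snd y e \<in> edges G" using y Bij_imp_funcset[of "snd y"] by (auto simp: c)
    then have "ends G (snd x (snd y e)) = fst x ` fst y ` ends G e" using x y e by (simp add: c)
    then show "ends G (snd (compose (verts G) (fst x) (fst y), compose (edges G) (snd x) (snd y)) e) =
        fst (compose (verts G) (fst x) (fst y), compose (edges G) (snd x) (snd y)) ` ends G e"
      using sub[OF e] e by (auto simp: compose_def image_image subset_iff)
  qed
  fix x y z assume x: "x \<in> carrier (graph_aut G)" and y: "y \<in> carrier (graph_aut G)"
  show xy: "x \<otimes>\<^bsub>graph_aut G\<^esub> y \<in> carrier (graph_aut G)" by (rule closed[OF x y])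
  show "\<one>\<^bsub>graph_aut G\<^esub> \<otimes>\<^bsub>graph_aut G\<^esub> x = x"
    using x \<open>\<one>\<^bsub>graph_aut G\<^esub> \<in> _\<close>
    by (subst graph_aut_mult) (auto simp: one c Bij_imp_funcset Bij_imp_extensional)
  show "x \<otimes>\<^bsub>graph_aut G\<^esub> \<one>\<^bsub>graph_aut G\<^esub> = x"
    using x \<open>\<one>\<^bsub>graph_aut G\<^esub> \<in> _\<close>
    by (subst graph_aut_mult)
       (auto simp: one c compose_Id[OF Bij_imp_funcset Bij_imp_extensional])
  assume z: "z \<in> carrier (graph_aut G)"
  have yz: "y \<otimes>\<^bsub>graph_aut G\<^esub> z \<in> carrier (graph_aut G)" by (rule closed[OF y z])
  have "fst z \<in> Bij (verts G)" "snd z \<in> Bij (edges G)" using z by (auto simp: c)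
  then show "x \<otimes>\<^bsub>graph_aut G\<^esub> y \<otimes>\<^bsub>graph_aut G\<^esub> z = x \<otimes>\<^bsub>graph_aut G\<^esub> (y \<otimes>\<^bsub>graph_aut G\<^esub> z)"
    unfolding graph_aut_mult[OF xy z] graph_aut_mult[OF x yz]
    unfolding graph_aut_mult[OF x y] graph_aut_mult[OF y z]
    by (simp add: compose_assoc[OF Bij_imp_funcset])
qed

text \<open>This reconciles the two index sets for a basis of the period group: the type of
  coordinates, and the initial segment of the naturals used for periodic graphs.\<close>

lemma free_Abelian_group_iso_bij:
  assumes "bij_betw f (UNIV :: 'd set) T"
  shows "free_Abelian_group (UNIV :: 'd set) \<cong> free_Abelian_group T"
proof -
  let ?h = "frag_extend (frag_of \<circ> f)"
  define f' where "f' = inv_into UNIV f"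
  have f': "f' (f x) = x" for x using assms by (simp add: f'_def bij_betw_def)
  have ff': "f (f' y) = y" if "y \<in> T" for y using assms that by (simp add: f'_def bij_betw_def f_inv_into_f)
  let ?g = "frag_extend (frag_of \<circ> f')"
  have keys: "Poly_Mapping.keys (?h c) \<subseteq> T" for c
    using keys_frag_extend[of "frag_of \<circ> f" c] assms by (auto simp: bij_betw_def)
  have "bij_betw ?h (carrier (free_Abelian_group UNIV)) (carrier (free_Abelian_group T))"
  proof (rule bij_betwI[where g = ?g])
    show "?h \<in> carrier (free_Abelian_group UNIV) \<rightarrow> carrier (free_Abelian_group T)"
      using keys by auto
    show "?g (?h c) = c" for c :: "'d \<Rightarrow>\<^sub>0 int"
    proof -
      have "Poly_Mapping.keys c \<subseteq> UNIV" by simp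
      then show ?thesis
        by (induction c rule: frag_induction) (simp_all add: f' frag_extend_diff)
    qed
    show "?h (?g c) = c" if "c \<in> carrier (free_Abelian_group T)" for c
    proof -
      have "Poly_Mapping.keys c \<subseteq> T" using that by simp
      then show ?thesis
        by (induction c rule: frag_induction) (simp_all add: ff' frag_extend_diff)
    qed
  qed auto
  moreover have "?h \<in> hom (free_Abelian_group UNIV) (free_Abelian_group T)"
    using keys by (intro homI) (simp_all add: frag_extend_add)
  ultimately show ?thesis by (auto simp: is_iso_def iso_def)
qed

abbreviation int_coords :: "('d::finite \<Rightarrow>\<^sub>0 int) \<Rightarrow> real ^ 'd" where
  "int_coords c \<equiv> int_vec (Poly_Mapping.lookup c)"

lemma int_coords_add [simp]: "int_coords (a + b) = int_coords a + int_coords b"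
  by (simp add: int_vec_def vec_eq_iff lookup_add)

lemma int_coords_0 [simp]: "int_coords 0 = 0"
  by (simp add: int_vec_def vec_eq_iff)

lemma int_coords_inject [simp]: "int_coords a = int_coords b \<longleftrightarrow> a = b"
  by (auto simp: int_vec_def vec_eq_iff intro: poly_mapping_eqI)

lemma int_vec_indicator: "int_vec (\<lambda>x. if x = k then 1 else 0) = axis k 1"
  by (simp add: int_vec_def vec_eq_iff axis_def)

text \<open>The data of a voltage graph. Its derived graph has vertices
  \<open>V \<times> UNIV\<close> and edges \<open>E \<times> UNIV\<close>, which \<open>iv\<close>
  and \<open>ie\<close> encode in the prescribed types. A loop needs a non-zero gain because its
  lifts must join distinct vertices.\<close>

locale gain_graph =
  fixes V :: "'v set" and E :: "'e set" and s t :: "'e \<Rightarrow> 'v" and c :: "'e \<Rightarrow> 'd::finite \<Rightarrow>\<^sub>0 int"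
    and iv :: "'v \<times> ('d \<Rightarrow>\<^sub>0 int) \<Rightarrow> 'a" and ie :: "'e \<times> ('d \<Rightarrow>\<^sub>0 int) \<Rightarrow> 'b"
  assumes finV: "finite V" and finE: "finite E" and neV: "V \<noteq> {}"
    and inj_iv: "inj_on iv (V \<times> UNIV)" and inj_ie: "inj_on ie (E \<times> UNIV)"
    and st: "\<And>e. e \<in> E \<Longrightarrow> s e \<in> V" "\<And>e. e \<in> E \<Longrightarrow> t e \<in> V"
    and loop: "\<And>e. e \<in> E \<Longrightarrow> s e = t e \<Longrightarrow> c e \<noteq> 0"
begin

definition "jv = inv_into (V \<times> UNIV) iv"
definition "je = inv_into (E \<times> UNIV) ie"

lemma jv [simp]: "v \<in> V \<Longrightarrow> jv (iv (v, z)) = (v, z)"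
  unfolding jv_def by (intro inv_into_f_f inj_iv) auto

lemma je [simp]: "e \<in> E \<Longrightarrow> je (ie (e, z)) = (e, z)"
  unfolding je_def by (intro inv_into_f_f inj_ie) auto

lemma iv_eq [simp]: "v \<in> V \<Longrightarrow> v' \<in> V \<Longrightarrow> iv (v, z) = iv (v', z') \<longleftrightarrow> v = v' \<and> z = z'"
  using inj_iv by (auto simp: inj_on_def)

lemma ie_eq [simp]: "e \<in> E \<Longrightarrow> e' \<in> E \<Longrightarrow> ie (e, z) = ie (e', z') \<longleftrightarrow> e = e' \<and> z = z'"
  using inj_ie by (auto simp: inj_on_def)

definition cover :: "('a, 'b) multigraph" where
  "cover = \<lparr>verts = iv ` (V \<times> UNIV), edges = ie ` (E \<times> UNIV),
     ends = (\<lambda>y. {iv (s (fst (je y)), snd (je y)), iv (t (fst (je y)), snd (je y) + c (fst (je y)))})\<rparr>"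

text \<open>The maps are restricted to vertices and edges because the elements of
  \<open>BijGroup\<close> are extensional.\<close>

definition shift :: "('d \<Rightarrow>\<^sub>0 int) \<Rightarrow> ('a, 'b) graph_perm" where
  "shift a = (\<lambda>x\<in>verts cover. iv (fst (jv x), snd (jv x) + a), \<lambda>y\<in>edges cover. ie (fst (je y), snd (je y) + a))"

lemma verts_cover: "x \<in> verts cover \<longleftrightarrow> (\<exists>v z. v \<in> V \<and> x = iv (v, z))"
  and edges_cover: "y \<in> edges cover \<longleftrightarrow> (\<exists>e z. e \<in> E \<and> y = ie (e, z))"
  by (auto simp: cover_def)

lemma iv_cover [simp]: "v \<in> V \<Longrightarrow> iv (v, z) \<in> verts cover"
  and ie_cover [simp]: "e \<in> E \<Longrightarrow> ie (e, z) \<in> edges cover"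
  by (auto simp: cover_def)

lemma ends_cover [simp]: "e \<in> E \<Longrightarrow> ends cover (ie (e, z)) = {iv (s e, z), iv (t e, z + c e)}"
  by (simp add: cover_def)

lemma shift_simps [simp]:
  "v \<in> V \<Longrightarrow> fst (shift a) (iv (v, z)) = iv (v, z + a)"
  "e \<in> E \<Longrightarrow> snd (shift a) (ie (e, z)) = ie (e, z + a)"
  by (simp_all add: shift_def)

lemma ends_distinct: "e \<in> E \<Longrightarrow> iv (s e, z) \<noteq> iv (t e, z + c e)"
  using st loop by auto

lemma card_ends_cover: "y \<in> edges cover \<Longrightarrow> card (ends cover y) = 2"
  using ends_distinct by (auto simp: edges_cover)

lemma multigraph_cover: "is_multigraph cover"
  unfolding is_multigraph_def using card_ends_cover st by (auto simp: edges_cover)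

lemma shift_carrier: "shift a \<in> carrier (graph_aut cover)"
proof -
  have "bij_betw (fst (shift a)) (verts cover) (verts cover)"
    by (rule bij_betwI[where g = "fst (shift (- a))"]) (auto dest!: verts_cover[THEN iffD1])
  moreover have "bij_betw (snd (shift a)) (edges cover) (edges cover)"
    by (rule bij_betwI[where g = "snd (shift (- a))"]) (auto dest!: edges_cover[THEN iffD1])
  moreover have "ends cover (snd (shift a) y) = fst (shift a) ` ends cover y" if "y \<in> edges cover" for y
    using that st by (auto simp: edges_cover add_ac)
  ultimately show ?thesis by (auto simp: graph_aut_def Bij_def shift_def)
qed

lemma shift_mult: "shift a \<otimes>\<^bsub>graph_aut cover\<^esub> shift b = shift (a + b)"
proof -
  have "compose (verts cover) (fst (shift a)) (fst (shift b)) = fst (shift (a + b))"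
    by (rule extensionalityI[of _ "verts cover"]) (auto simp: verts_cover compose_def add_ac, auto simp: shift_def)
  moreover have "compose (edges cover) (snd (shift a)) (snd (shift b)) = snd (shift (a + b))"
    by (rule extensionalityI[of _ "edges cover"]) (auto simp: edges_cover compose_def add_ac, auto simp: shift_def)
  ultimately show ?thesis by (simp add: graph_aut_mult[OF shift_carrier shift_carrier])
qed

lemma shift_0: "shift 0 = \<one>\<^bsub>graph_aut cover\<^esub>"
  by (auto simp: graph_aut_def BijGroup_def shift_def fun_eq_iff verts_cover edges_cover)

lemma shift_eq_iff [simp]: "shift a = shift b \<longleftrightarrow> a = b"
proof
  obtain v where v: "v \<in> V" using neV by blast
  assume "shift a = shift b"
  then have "fst (shift a) (iv (v, 0)) = fst (shift b) (iv (v, 0))" by simp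
  then show "a = b" using v by simp
qed simp

lemma subgroup_shift: "subgroup (range shift) (graph_aut cover)"
proof
  show "range shift \<subseteq> carrier (graph_aut cover)" using shift_carrier by auto
  show "x \<otimes>\<^bsub>graph_aut cover\<^esub> y \<in> range shift" if "x \<in> range shift" "y \<in> range shift" for x y
    using that by (auto simp: shift_mult)
  show "\<one>\<^bsub>graph_aut cover\<^esub> \<in> range shift" by (simp flip: shift_0)
  interpret monoid "graph_aut cover" by (rule monoid_graph_aut[OF multigraph_cover])
  have "inv\<^bsub>graph_aut cover\<^esub> shift a = shift (- a)" for a
    by (rule inv_unique'[symmetric]) (simp_all add: shift_carrier shift_mult shift_0)
  then show "inv\<^bsub>graph_aut cover\<^esub> x \<in> range shift" if "x \<in> range shift" for x using that by auto
qed

lemma shift_iso: "shift \<in> iso (free_Abelian_group UNIV) (aut_subgroup cover (range shift))"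
  by (auto simp: iso_def hom_def shift_mult bij_betw_def inj_on_def)

sublocale period_action cover "range shift" shift
  using multigraph_cover shift_carrier shift_iso by unfold_locales auto

lemma vorbit_iv: "v \<in> V \<Longrightarrow> vorbit (iv (v, z)) = iv ` ({v} \<times> UNIV)"
proof -
  assume v: "v \<in> V"
  have "range (\<lambda>a. iv (v, z + a)) = (\<lambda>b. iv (v, b)) ` range (\<lambda>a. z + a)" by (simp only: image_image)
  also have "range (\<lambda>a. z + a) = UNIV" by (rule surjI[of _ "\<lambda>b. b - z"]) simp
  finally show ?thesis using v by (auto simp: vorbit_eq)
qed

lemma eorbit_ie: "e \<in> E \<Longrightarrow> eorbit (ie (e, z)) = ie ` ({e} \<times> UNIV)"
proof -
  assume e: "e \<in> E"
  have "range (\<lambda>a. ie (e, z + a)) = (\<lambda>b. ie (e, b)) ` range (\<lambda>a. z + a)" by (simp only: image_image)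
  also have "range (\<lambda>a. z + a) = UNIV" by (rule surjI[of _ "\<lambda>b. b - z"]) simp
  finally show ?thesis using e by (auto simp: eorbit_eq)
qed

abbreviation "qgraph \<equiv> quotient_graph cover (range shift)"

lemma verts_quotient: "verts qgraph = (\<lambda>v. iv ` ({v} \<times> UNIV)) ` V"
  using vorbit_iv by (auto simp: quotient_graph_def orbits_def verts_cover) metis+

lemma edges_quotient: "edges qgraph = (\<lambda>e. ie ` ({e} \<times> UNIV)) ` E"
  using eorbit_ie by (auto simp: quotient_graph_def orbits_def edges_cover) metis+

lemma inj_fibre: "inj_on (\<lambda>v. iv ` ({v} \<times> UNIV)) V" "inj_on (\<lambda>e. ie ` ({e} \<times> UNIV)) E"
proof -
  have "v = v'" if "v \<in> V" "v' \<in> V" "iv ` ({v} \<times> UNIV) = iv ` ({v'} \<times> UNIV)" for v v'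
  proof -
    have "iv (v, 0) \<in> iv ` ({v'} \<times> UNIV)" using that(3) by blast
    then show ?thesis using that by auto
  qed
  then show "inj_on (\<lambda>v. iv ` ({v} \<times> UNIV)) V" by (rule inj_onI)
  have "e = e'" if "e \<in> E" "e' \<in> E" "ie ` ({e} \<times> UNIV) = ie ` ({e'} \<times> UNIV)" for e e'
  proof -
    have "ie (e, 0) \<in> ie ` ({e'} \<times> UNIV)" using that(3) by blast
    then show ?thesis using that by auto
  qed
  then show "inj_on (\<lambda>e. ie ` ({e} \<times> UNIV)) E" by (rule inj_onI)
qed

lemma quotient_iso:
  assumes "verts Q = V" "edges Q = E" "\<And>e. e \<in> E \<Longrightarrow> ends Q e = {s e, t e}"
  shows "multigraph_iso Q qgraph"
  unfolding multigraph_iso_def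
proof (intro exI conjI ballI)
  show "bij_betw (\<lambda>v. iv ` ({v} \<times> UNIV)) (verts Q) (verts qgraph)"
    "bij_betw (\<lambda>e. ie ` ({e} \<times> UNIV)) (edges Q) (edges qgraph)"
    using assms inj_fibre verts_quotient edges_quotient by (auto simp: bij_betw_def)
  fix e assume "e \<in> edges Q"
  then have e: "e \<in> E" using assms by simp
  have "ends qgraph (ie ` ({e} \<times> UNIV)) = vorbit ` ends cover (ie (e, 0))"
    using ends_quotient[of "ie (e, 0)"] e eorbit_ie by simp
  then show "ends qgraph (ie ` ({e} \<times> UNIV)) = (\<lambda>v. iv ` ({v} \<times> UNIV)) ` ends Q e"
    using e assms(3) st vorbit_iv by simp
qed

lemma periodic_graph_cover: "periodic_graph CARD('d) cover (range shift)"
proof -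
  obtain f :: "'d \<Rightarrow> nat" where "bij_betw f UNIV {..<CARD('d)}"
    using ex_bij_betw_finite_nat[of "UNIV :: 'd set"] by (auto simp: atLeast0LessThan)
  then have 1: "free_Abelian_group (UNIV :: 'd set) \<cong> free_Abelian_group {..<CARD('d)}"
    by (rule free_Abelian_group_iso_bij)
  have "free_Abelian_group (UNIV :: 'd set) \<cong> aut_subgroup cover (range shift)"
    by (rule is_isoI[OF shift_iso])
  then have "aut_subgroup cover (range shift) \<cong> free_Abelian_group (UNIV :: 'd set)"
    by (rule group.iso_sym[OF group_free_Abelian_group])
  then have iso: "aut_subgroup cover (range shift) \<cong> free_Abelian_group {..<CARD('d)}"
    using 1 by (rule iso_trans)
  obtain v where v: "v \<in> V" using neV by blast
  \<comment> \<open>Infinitely many vertices lie over \<open>v\<close> along one coordinate axis;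
    \<open>undefined\<close> only serves to name some axis.\<close>
  have "inj (\<lambda>n::int. iv (v, Poly_Mapping.single (undefined :: 'd) n))"
    using v by (auto simp: inj_on_def) (metis lookup_single_eq)
  then have "infinite (range (\<lambda>n::int. iv (v, Poly_Mapping.single (undefined :: 'd) n)))"
    using infinite_UNIV_int by (simp add: finite_image_iff)
  then have inf: "infinite (verts cover)"
    by (rule infinite_super[rotated]) (use v iv_cover in blast)
  have free: "fst \<gamma> x \<noteq> x" if "\<gamma> \<in> range shift" "\<gamma> \<noteq> \<one>\<^bsub>graph_aut cover\<^esub>" "x \<in> verts cover" for \<gamma> x
    using that by (auto simp: verts_cover simp flip: shift_0)
  show ?thesis
    unfolding periodic_graph_def
    using multigraph_cover card_ends_cover inf subgroup_shift iso free finV finE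
    by (auto simp: loopless_def verts_quotient edges_quotient)
qed

text \<open>Edges of gain 0 connect each level. The edges with basis vectors as gains connect
  neighbouring levels, and reachability is symmetric, so the periods that can be travelled from
  every level are closed under differences and form the whole group.\<close>

lemma connected_cover:
  assumes conn: "\<And>u v. u \<in> V \<Longrightarrow> v \<in> V \<Longrightarrow> (\<lambda>x y. \<exists>e\<in>E. c e = 0 \<and> {s e, t e} = {x, y})\<^sup>*\<^sup>* u v"
    and gen: "\<And>k. \<exists>e\<in>E. c e = frag_of k"
  shows "connected_multigraph cover"
proof -
  let ?r = "\<lambda>x y. \<exists>e\<in>edges cover. ends cover e = {x, y}"
  have sym: "?r\<^sup>*\<^sup>* y x" if "?r\<^sup>*\<^sup>* x y" for x y
    using that by (rule sympD[OF symp_rtranclp, rotated]) (auto simp: symp_def insert_commute)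
  have level: "?r\<^sup>*\<^sup>* (iv (u, z)) (iv (v, z))" if "u \<in> V" "v \<in> V" for u v z
    using conn[OF that]
  proof (induction rule: rtranclp_induct)
    case (step y w)
    then obtain e where e: "e \<in> E" "c e = 0" "{s e, t e} = {y, w}" by blast
    have "ends cover (ie (e, z)) = (\<lambda>x. iv (x, z)) ` {s e, t e}" using e(1,2) by simp
    also have "\<dots> = {iv (y, z), iv (w, z)}" unfolding e(3) by simp
    finally have "?r (iv (y, z)) (iv (w, z))" using e(1) ie_cover by blast
    with step.IH show ?case by (rule rtranclp.rtrancl_into_rtrancl)
  qed simp
  obtain v0 where v0: "v0 \<in> V" using neV by blast
  have "\<forall>z. ?r\<^sup>*\<^sup>* (iv (v0, z)) (iv (v0, z + a))" for a
  proof (rule free_Abelian_group_induct[of a UNIV])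
    fix a b assume a: "\<forall>z. ?r\<^sup>*\<^sup>* (iv (v0, z)) (iv (v0, z + a))" and b: "\<forall>z. ?r\<^sup>*\<^sup>* (iv (v0, z)) (iv (v0, z + b))"
    show "\<forall>z. ?r\<^sup>*\<^sup>* (iv (v0, z)) (iv (v0, z + (a - b)))"
    proof
      fix z
      \<comment> \<open>The path for \<open>b\<close>, started at level \<open>z + (a - b)\<close>,
        ends at \<open>z + a\<close> and is traversed backwards.\<close>
      have "?r\<^sup>*\<^sup>* (iv (v0, z + (a - b))) (iv (v0, z + a))" using b[rule_format, of "z + (a - b)"] by simp
      from rtranclp_trans[OF a[rule_format, of z] sym[OF this]]
      show "?r\<^sup>*\<^sup>* (iv (v0, z)) (iv (v0, z + (a - b)))" .
    qed
  next
    fix k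
    obtain e where e: "e \<in> E" "c e = frag_of k" using gen by blast
    show "\<forall>z. ?r\<^sup>*\<^sup>* (iv (v0, z)) (iv (v0, z + frag_of k))"
    proof
      fix z
      have 1: "?r\<^sup>*\<^sup>* (iv (v0, z)) (iv (s e, z))" using level v0 st e by simp
      have 2: "?r (iv (s e, z)) (iv (t e, z + frag_of k))"
        using e by (intro bexI[of _ "ie (e, z)"]) auto
      have 3: "?r\<^sup>*\<^sup>* (iv (t e, z + frag_of k)) (iv (v0, z + frag_of k))" using level v0 st e by simp
      from rtranclp_trans[OF rtranclp.rtrancl_into_rtrancl[OF 1 2] 3]
      show "?r\<^sup>*\<^sup>* (iv (v0, z)) (iv (v0, z + frag_of k))" .
    qed
  qed auto
  then have up: "?r\<^sup>*\<^sup>* (iv (v0, 0)) (iv (v0, 0 + a))" for a by blast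
  have reach: "?r\<^sup>*\<^sup>* (iv (v0, 0)) x" if "x \<in> verts cover" for x
  proof -
    obtain v z where x: "v \<in> V" "x = iv (v, z)" using \<open>x \<in> verts cover\<close> verts_cover by auto
    show ?thesis unfolding x(2) using rtranclp_trans[OF up[of z]] level[OF v0 x(1), of z] by simp
  qed
  show ?thesis
    unfolding connected_multigraph_def
  proof (intro ballI)
    fix x y assume "x \<in> verts cover" "y \<in> verts cover"
    then show "?r\<^sup>*\<^sup>* x y" using rtranclp_trans[OF sym[OF reach] reach] by blast
  qed
qed

end

section \<open>A framework with prescribed bars\<close>

lemma dim_range_singles:
  assumes "finite E"
  shows "dim (range (\<lambda>x. \<Sum>e\<in>E. Poly_Mapping.single e (x e :: real))) = card E"
proof (rule dim_unique[of "(\<lambda>e. Poly_Mapping.single e (1::real)) ` E"])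
  let ?T = "(\<lambda>e. Poly_Mapping.single e (1::real)) ` E"
  have inj: "inj_on (\<lambda>e. Poly_Mapping.single e (1::real)) E"
    by (intro inj_onI) (metis lookup_single_eq lookup_single_not_eq zero_neq_one)
  show "card ?T = card E" using inj by (rule card_image)
  show "?T \<subseteq> range (\<lambda>x. \<Sum>e\<in>E. Poly_Mapping.single e (x e :: real))"
  proof
    fix y assume "y \<in> ?T"
    then obtain e where e: "e \<in> E" "y = Poly_Mapping.single e 1" by blast
    have "(\<Sum>f\<in>E. Poly_Mapping.single f (if f = e then 1 else 0 :: real)) = (\<Sum>f\<in>E. if f = e then y else 0)"
      using e(2) by (intro sum.cong) auto
    then have "y = (\<Sum>f\<in>E. Poly_Mapping.single f (if f = e then 1 else 0 :: real))"
      using assms e(1) by simp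
    then show "y \<in> range (\<lambda>x. \<Sum>e\<in>E. Poly_Mapping.single e (x e :: real))"
      by (rule range_eqI[of _ _ "\<lambda>f. if f = e then 1 else 0"])
  qed
  show "range (\<lambda>x. \<Sum>e\<in>E. Poly_Mapping.single e (x e :: real)) \<subseteq> span ?T"
  proof
    fix y assume "y \<in> range (\<lambda>x. \<Sum>e\<in>E. Poly_Mapping.single e (x e :: real))"
    then obtain x where "y = (\<Sum>e\<in>E. Poly_Mapping.single e (x e :: real))" by blast
    then have "y = (\<Sum>e\<in>E. x e *\<^sub>R Poly_Mapping.single e 1)" by (simp flip: single_eq_scaleR)
    then show "y \<in> span ?T" by (simp only:) (intro span_sum span_scale span_base imageI)
  qed
  show "independent ?T"
  proof (rule independent_if_scalars_zero)
    fix f x assume f: "(\<Sum>x\<in>?T. f x *\<^sub>R x) = 0" and x: "x \<in> ?T"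
    obtain e where e: "e \<in> E" "x = Poly_Mapping.single e 1" using x by blast
    have "(\<Sum>x\<in>?T. f x *\<^sub>R x) = (\<Sum>e\<in>E. Poly_Mapping.single e (f (Poly_Mapping.single e 1)))"
      using inj by (simp add: sum.reindex flip: single_eq_scaleR)
    then have "Poly_Mapping.lookup (\<Sum>e\<in>E. Poly_Mapping.single e (f (Poly_Mapping.single e 1))) e = 0"
      using f by simp
    then show "f x = 0" using lookup_sum_single[OF assms e(1), of "\<lambda>e. f (Poly_Mapping.single e 1)"] e(2) by simp
  qed (use assms in simp)
qed

context gain_graph
begin

text \<open>The lattice is \<open>\<int>\<close>\<open>\<^sup>d\<close>, and the bar over \<open>e\<close> at level \<open>z\<close> goes from \<open>z\<close>, the
  position of its source, to \<open>z + w e\<close>.\<close>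

definition standard_framework :: "('e \<Rightarrow> real ^ 'd) \<Rightarrow> ('a, 'b, 'd) framework" where
  "standard_framework w = \<lparr>graph = cover, periods = range shift,
     pos = (\<lambda>x. int_coords (snd (jv x))), rot = (\<lambda>_. mat 1),
     translation = (\<lambda>\<gamma>. int_coords (inv_into UNIV shift \<gamma>)),
     attach = (\<lambda>x y. if x = iv (s (fst (je y)), snd (je y)) then 0
                     else w (fst (je y)) - int_coords (c (fst (je y))))\<rparr>"

definition standard_reps :: "('a, 'b, 'd) representatives" where
  "standard_reps = \<lparr>basis_iso = shift, vreps = (\<lambda>v. iv (v, 0)) ` V, ereps = (\<lambda>e. ie (e, 0)) ` E,
     src = (\<lambda>y. iv (s (fst (je y)), 0)), tgt = (\<lambda>y. iv (t (fst (je y)), 0)),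
     gain = (\<lambda>y. c (fst (je y)))\<rparr>"

lemma inv_shift [simp]: "inv_into UNIV shift (shift a) = a"
  by (rule inv_into_f_f) (auto simp: inj_on_def)

lemma standard_framework_simps [simp]:
  "graph (standard_framework w) = cover" "periods (standard_framework w) = range shift"
  "v \<in> V \<Longrightarrow> pos (standard_framework w) (iv (v, z)) = int_coords z"
  "rot (standard_framework w) x = mat 1"
  "translation (standard_framework w) (shift a) = int_coords a"
  "e \<in> E \<Longrightarrow> attach (standard_framework w) x (ie (e, z)) = (if x = iv (s e, z) then 0 else w e - int_coords (c e))"
  by (simp_all add: standard_framework_def)

text \<open>The target body sits at \<open>z + c e\<close>, so its attachment point
  \<open>w e - int_coords (c e)\<close> lies at \<open>z + w e\<close> in space.\<close>

lemma bar_end_standard [simp]: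
  "e \<in> E \<Longrightarrow> bar_end (standard_framework w) (iv (s e, z)) (ie (e, z)) = int_coords z"
  "e \<in> E \<Longrightarrow> bar_end (standard_framework w) (iv (t e, z + c e)) (ie (e, z)) = int_coords z + w e"
  using st ends_distinct by (auto simp: bar_end_def)

lemma full_lattice_standard: "full_lattice (range (int_coords :: ('d \<Rightarrow>\<^sub>0 int) \<Rightarrow> real ^ 'd))"
  unfolding full_lattice_def
proof (intro exI conjI)
  show "invertible (mat 1 :: real ^ 'd ^ 'd)" by (auto simp: invertible_def intro!: exI[of _ "mat 1"])
  have "range Poly_Mapping.lookup = (UNIV :: ('d \<Rightarrow> int) set)"
    by (rule surjI[of _ Abs_poly_mapping]) simp
  then have "range (int_coords :: ('d \<Rightarrow>\<^sub>0 int) \<Rightarrow> real ^ 'd) = range int_vec"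
    by (metis (no_types, lifting) image_cong image_image)
  then show "range (int_coords :: ('d \<Rightarrow>\<^sub>0 int) \<Rightarrow> real ^ 'd) = range (\<lambda>c. mat 1 *v int_vec c)"
    by simp
qed

lemma presentation_standard: "presentation (standard_framework w)"
  unfolding presentation_def
proof (intro conjI ballI)
  fix \<gamma> \<delta> assume g: "\<gamma> \<in> periods (standard_framework w)"
  then obtain a where a: "\<gamma> = shift a" by auto
  {
    assume "\<delta> \<in> periods (standard_framework w)"
    then obtain b where "\<delta> = shift b" by auto
    then show "translation (standard_framework w) (\<gamma> \<otimes>\<^bsub>graph_aut (graph (standard_framework w))\<^esub> \<delta>) =
        translation (standard_framework w) \<gamma> + translation (standard_framework w) \<delta>"
      by (simp add: a shift_mult)
  }
  {
    fix x assume "x \<in> verts (graph (standard_framework w))"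
    then obtain v z where "v \<in> V" "x = iv (v, z)" by (auto simp: verts_cover)
    then show "pos (standard_framework w) (fst \<gamma> x) = pos (standard_framework w) x + translation (standard_framework w) \<gamma>"
      "rot (standard_framework w) (fst \<gamma> x) = rot (standard_framework w) x"
      by (simp_all add: a)
  }
  {
    fix y x assume "y \<in> edges (graph (standard_framework w))" and x: "x \<in> ends (graph (standard_framework w)) y"
    then obtain e z where e: "e \<in> E" "y = ie (e, z)" by (auto simp: edges_cover)
    then obtain v z' where v: "v \<in> V" "x = iv (v, z')" using x st by auto
    show "attach (standard_framework w) (fst \<gamma> x) (snd \<gamma> y) = attach (standard_framework w) x y"
      using e v st by (simp add: a)
  }
next
  show "inj_on (translation (standard_framework w)) (periods (standard_framework w))"
    by (auto simp: inj_on_def)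
  have "translation (standard_framework w) ` periods (standard_framework w) = range int_coords"
    by (simp add: image_image)
  then show "full_lattice (translation (standard_framework w) ` periods (standard_framework w))"
    using full_lattice_standard by simp
qed (auto simp: rotation_matrix_def orthogonal_matrix_id)

lemma periodic_framework_standard:
  assumes conn: "\<And>u v. u \<in> V \<Longrightarrow> v \<in> V \<Longrightarrow> (\<lambda>x y. \<exists>e\<in>E. c e = 0 \<and> {s e, t e} = {x, y})\<^sup>*\<^sup>* u v"
    and gen: "\<And>k. \<exists>e\<in>E. c e = frag_of k" and w: "\<And>e. e \<in> E \<Longrightarrow> w e \<noteq> 0"
  shows "periodic_framework (standard_framework w)"
  unfolding periodic_framework_def
proof (intro conjI ballI allI impI)
  fix y x x' assume "y \<in> edges (graph (standard_framework w))"
    and x: "ends (graph (standard_framework w)) y = {x, x'} \<and> x \<noteq> x'"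
  then obtain e z where e: "e \<in> E" "y = ie (e, z)" by (auto simp: edges_cover)
  then have "{iv (s e, z), iv (t e, z + c e)} = {x, x'}" using x by simp
  then have "(x = iv (s e, z) \<and> x' = iv (t e, z + c e)) \<or> (x' = iv (s e, z) \<and> x = iv (t e, z + c e))"
    by (auto simp: doubleton_eq_iff)
  then show "bar_end (standard_framework w) x y \<noteq> bar_end (standard_framework w) x' y"
    using w[OF e(1)] e by auto
qed (use periodic_graph_cover connected_cover[OF conn gen] presentation_standard in simp_all)

lemma standard_reps_simps [simp]:
  "basis_iso standard_reps = shift" "vreps standard_reps = (\<lambda>v. iv (v, 0)) ` V"
  "ereps standard_reps = (\<lambda>e. ie (e, 0)) ` E"
  "e \<in> E \<Longrightarrow> src standard_reps (ie (e, z)) = iv (s e, 0)"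
  "e \<in> E \<Longrightarrow> tgt standard_reps (ie (e, z)) = iv (t e, 0)"
  "e \<in> E \<Longrightarrow> gain standard_reps (ie (e, z)) = c e"
  by (simp_all add: standard_reps_def)

lemma far_end_standard [simp]: "e \<in> E \<Longrightarrow> far_end standard_reps (ie (e, 0)) = iv (t e, 0 + c e)"
  using st by (simp add: far_end_def)

lemma valid_standard: "valid_representatives (standard_framework w) standard_reps"
  unfolding valid_representatives_def
proof (intro conjI ballI)
  fix X assume "X \<in> verts (quotient_graph (graph (standard_framework w)) (periods (standard_framework w)))"
  then obtain v where v: "v \<in> V" "X = iv ` ({v} \<times> UNIV)" by (auto simp: verts_quotient)
  show "\<exists>!x. x \<in> vreps standard_reps \<and> x \<in> X"
    by (rule ex1I[of _ "iv (v, 0)"]) (use v in auto)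
next
  fix X assume "X \<in> edges (quotient_graph (graph (standard_framework w)) (periods (standard_framework w)))"
  then obtain e where e: "e \<in> E" "X = ie ` ({e} \<times> UNIV)" by (auto simp: edges_quotient)
  show "\<exists>!x. x \<in> ereps standard_reps \<and> x \<in> X"
    by (rule ex1I[of _ "ie (e, 0)"]) (use e in auto)
qed (use shift_iso st in auto)

lemma period_matrix_standard: "period_matrix (standard_framework w) standard_reps = mat 1"
  by (simp add: period_matrix_def mat_def vec_eq_iff int_vec_def)

text \<open>The bar starts at the origin of its source body, so the rotation of the source drops out
  and the equation contains only the rotation of the target. The triangular form of the system
  depends on this.\<close>

lemma bar_equation_standard:
  assumes e: "e \<in> E"
  shows "bar_equation (standard_framework w) standard_reps p A L (ie (e, 0)) =
    (L *v int_coords (c e) + A (iv (t e, 0)) *v (w e - int_coords (c e)) + p (iv (t e, 0)) - p (iv (s e, 0))) \<bullet> w e"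
proof -
  have "src_attach (standard_framework w) standard_reps (ie (e, 0)) = 0"
    using e bar_end_standard(1)[OF e, of w 0] by (simp add: src_attach_def)
  moreover have "tgt_attach (standard_framework w) standard_reps (ie (e, 0)) = w e - int_coords (c e)"
    using e bar_end_standard(2)[OF e, of w 0] by (simp add: tgt_attach_def)
  ultimately show ?thesis
    using e by (simp add: bar_equation_def gain_vec_def period_matrix_standard)
qed

text \<open>If every right-hand side is attained, the column space is all of the space indexed by
  the edges, and its dimension is their number.\<close>

lemma rigidity_rank_standard:
  assumes surj: "\<And>y :: 'e \<Rightarrow> real. \<exists>p A L. (\<forall>v\<in>V. transpose (A v) = - A v) \<and>
    (\<forall>e\<in>E. (L *v int_coords (c e) + A (t e) *v (w e - int_coords (c e)) + p (t e) - p (s e)) \<bullet> w e = y e)"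
  shows "rigidity_rank (standard_framework w) standard_reps = card E"
proof -
  let ?E = "ereps standard_reps" and ?beq = "bar_equation (standard_framework w) standard_reps"
  have "{(\<Sum>e \<in> ?E. Poly_Mapping.single e (?beq p A L e)) | p A L. \<forall>v \<in> vreps standard_reps. transpose (A v) = - A v}
      = range (\<lambda>x. \<Sum>e\<in>?E. Poly_Mapping.single e (x e :: real))" (is "?I = ?J")
  proof
    show "?I \<subseteq> ?J" by auto
    show "?J \<subseteq> ?I"
    proof
      fix y assume "y \<in> ?J"
      then obtain x where y: "y = (\<Sum>e\<in>?E. Poly_Mapping.single e (x e :: real))" by blast
      obtain p A L where skew: "\<forall>v\<in>V. transpose (A v) = - A v" and eq: "\<And>e. e \<in> E \<Longrightarrow>
          (L *v int_coords (c e) + A (t e) *v (w e - int_coords (c e)) + p (t e) - p (s e)) \<bullet> w e = x (ie (e, 0))"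
        using surj[of "\<lambda>e. x (ie (e, 0))"] by blast
      let ?p = "\<lambda>u. p (fst (jv u))" and ?A = "\<lambda>u. A (fst (jv u))"
      have "?beq ?p ?A L e = x e" if "e \<in> ?E" for e
        using that eq st by (auto simp: bar_equation_standard)
      then have "y = (\<Sum>e \<in> ?E. Poly_Mapping.single e (?beq ?p ?A L e))" unfolding y by (intro sum.cong) auto
      moreover have "\<forall>v \<in> vreps standard_reps. transpose (?A v) = - ?A v" using skew by auto
      ultimately show "y \<in> ?I" by blast
    qed
  qed
  then have "rigidity_rank (standard_framework w) standard_reps = card ?E"
    unfolding rigidity_rank_def using dim_range_singles[of ?E] finE by simp
  also have "\<dots> = card E"
    unfolding standard_reps_simps by (rule card_image) (auto simp: inj_on_def)
  finally show ?thesis .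
qed

end

section \<open>Decomposable graphs are realised by rigid frameworks\<close>

lemma matrix_axis_entry: "(M *v axis l 1) $ k = M $ k $ l" for M :: "real ^ 'd ^ 'd::finite"
  by (simp add: matrix_vector_mult_basis column_def)

text \<open>A finite set times the integer lattice is countable and so embeds in any infinite
  type.\<close>

lemma ex_inj_on_cover:
  assumes "finite A"
  shows "\<exists>f :: 'v \<times> ('d::finite \<Rightarrow>\<^sub>0 int) \<Rightarrow> 'a::infinite. inj_on f (A \<times> UNIV)"
proof -
  have "inj (Poly_Mapping.lookup :: ('d \<Rightarrow>\<^sub>0 int) \<Rightarrow> 'd \<Rightarrow> int)"
    by (auto simp: inj_on_def intro: poly_mapping_eqI)
  then have "countable (UNIV :: ('d \<Rightarrow>\<^sub>0 int) set)"
    by (rule countable_image_inj_on[rotated]) simp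
  then have "countable (A \<times> (UNIV :: ('d \<Rightarrow>\<^sub>0 int) set))"
    using assms by (intro countable_SIGMA) (auto intro: countable_finite)
  then have 1: "inj_on (to_nat_on (A \<times> UNIV)) (A \<times> (UNIV :: ('d \<Rightarrow>\<^sub>0 int) set))"
    by (rule inj_on_to_nat_on)
  obtain g :: "nat \<Rightarrow> 'a" where g: "inj g"
    using infinite_countable_subset[OF infinite_UNIV] by blast
  have "inj_on (g \<circ> to_nat_on (A \<times> UNIV)) (A \<times> (UNIV :: ('d \<Rightarrow>\<^sub>0 int) set))"
    using 1 g by (auto intro: comp_inj_on inj_on_subset)
  then show ?thesis by blast
qed

text \<open>If the edges split between a component and its complement, the two sparsity bounds add
  up to \<open>d n - 2 d\<close>, less than the required \<open>d n - d\<close>.\<close>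

lemma tight_connected:
  assumes tight: "tight d (- int d) (spanning_subgraph Q E)" and d: "d \<ge> 1"
    and finV: "finite (verts Q)" and finE: "finite E"
    and ends: "\<And>e. e \<in> E \<Longrightarrow> ends Q e = {s e, t e} \<and> s e \<in> verts Q \<and> t e \<in> verts Q"
    and uv: "u \<in> verts Q" "v \<in> verts Q"
  shows "(\<lambda>x y. \<exists>e\<in>E. {s e, t e} = {x, y})\<^sup>*\<^sup>* u v"
proof (rule ccontr)
  let ?r = "\<lambda>x y. \<exists>e\<in>E. {s e, t e} = {x, y}"
  assume neg: "\<not> ?r\<^sup>*\<^sup>* u v"
  define C where "C = {x \<in> verts Q. ?r\<^sup>*\<^sup>* u x}"
  define D where "D = verts Q - C"
  have C: "C \<subseteq> verts Q" "C \<noteq> {}" using uv by (auto simp: C_def)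
  have D: "D \<subseteq> verts Q" "D \<noteq> {}" using uv neg by (auto simp: C_def D_def)
  have step: "y \<in> C" if "x \<in> C" "e \<in> E" "{s e, t e} = {x, y}" for x y e
  proof -
    have "?r x y" using that by blast
    moreover have "?r\<^sup>*\<^sup>* u x" using that(1) by (simp add: C_def)
    ultimately have "?r\<^sup>*\<^sup>* u y" by (rule rtranclp.rtrancl_into_rtrancl[rotated])
    moreover have "y \<in> verts Q" using ends[OF that(2)] that(3) by (auto simp: doubleton_eq_iff)
    ultimately show ?thesis by (simp add: C_def)
  qed
  have split: "ends Q e \<subseteq> C \<or> ends Q e \<subseteq> D" if e: "e \<in> E" for e
    using step[OF _ e, of "s e" "t e"] step[OF _ e, of "t e" "s e"] ends[OF e]
    by (auto simp: D_def insert_commute)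
  have fin: "finite {e \<in> E. ends Q e \<subseteq> S}" for S using finE by simp
  have "E \<subseteq> {e \<in> E. ends Q e \<subseteq> C} \<union> {e \<in> E. ends Q e \<subseteq> D}" using split by blast
  then have "card E \<le> card ({e \<in> E. ends Q e \<subseteq> C} \<union> {e \<in> E. ends Q e \<subseteq> D})"
    using fin by (intro card_mono) auto
  also have "\<dots> \<le> card {e \<in> E. ends Q e \<subseteq> C} + card {e \<in> E. ends Q e \<subseteq> D}" by (rule card_Un_le)
  finally have "int (card E) \<le> int (card {e \<in> E. ends Q e \<subseteq> C}) + int (card {e \<in> E. ends Q e \<subseteq> D})"
    by simp
  moreover have "int (card {e \<in> E. ends Q e \<subseteq> S}) \<le> int d * int (card S) - int d"
    if "S \<subseteq> verts Q" "S \<noteq> {}" for S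
    using tight that by (simp add: tight_def sparsity_type_def spanning_subgraph_def)
  from this[OF C] this[OF D]
  have "int (card {e \<in> E. ends Q e \<subseteq> C}) + int (card {e \<in> E. ends Q e \<subseteq> D}) \<le>
      int d * (int (card C) + int (card D)) - 2 * int d" by (simp add: distrib_left)
  moreover have "card C + card D = card (verts Q)"
    unfolding D_def using C(1) finV by (simp add: card_Diff_subset finite_subset card_mono)
  then have "int (card C) + int (card D) = int (card (verts Q))" by (simp flip: of_nat_add)
  moreover have "int (card E) = int d * int (card (verts Q)) - int d"
    using tight by (simp add: tight_def spanning_subgraph_def)
  ultimately show False using d by simp
qed

lemma decomposition_imp_rigid_framework:
  fixes Q :: "('v, 'e) multigraph"
  assumes Q: "finite_multigraph Q" and n: "card (verts Q) \<ge> 1"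
    and m: "card (edges Q) = ((CARD('d) + 1) choose 2) * (card (verts Q) - 1) + (CARD('d::finite))\<^sup>2"
    and dec: "sparse_decomposition CARD('d) Q"
  shows "\<exists>F :: ('a::infinite, 'b::infinite, 'd) framework.
         periodic_framework F \<and> infinitesimally_rigid F \<and>
         multigraph_iso Q (quotient_graph (graph F) (periods F))"
proof -
  let ?V = "verts Q" and ?E = "edges Q"
  have finV: "finite ?V" and finE: "finite ?E" and mg: "is_multigraph Q"
    using Q by (auto simp: finite_multigraph_def)
  have neV: "?V \<noteq> {}" using n by auto
  have "\<exists>a b. ends Q e = {a, b}" if "e \<in> ?E" for e
  proof -
    have "card (ends Q e) = 1 \<or> card (ends Q e) = 2" using mg that by (auto simp: is_multigraph_def)
    then show ?thesis by (metis card_1_singletonE card_2_iff insert_absorb2)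
  qed
  then obtain s0 t0 where st0: "\<And>e. e \<in> ?E \<Longrightarrow> ends Q e = {s0 e, t0 e}" by metis
  have st0V: "s0 e \<in> ?V" "t0 e \<in> ?V" if "e \<in> ?E" for e
    using st0[OF that] mg that by (auto simp: is_multigraph_def)
  obtain E1 E2 where E: "E1 \<inter> E2 = {}" "E1 \<union> E2 = ?E"
    and t1: "tight CARD('d) (- int CARD('d)) (spanning_subgraph Q E1)"
    and t2: "tight (CARD('d) choose 2) (int ((CARD('d) + 1) choose 2)) (spanning_subgraph Q E2)"
    using dec by (auto simp: sparse_decomposition_def)
  have E1: "e \<in> ?E" if "e \<in> E1" for e using E that by blast
  have E2: "e \<in> ?E" "e \<notin> E1" if "e \<in> E2" for e using E that by auto
  have finE1: "finite E1" using E1 finE by (auto intro: finite_subset)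
  have sparse1: "card {e\<in>E1. s0 e \<in> S \<and> t0 e \<in> S} + CARD('d) \<le> CARD('d) * card S"
    if S: "S \<subseteq> ?V" "S \<noteq> {}" for S
  proof -
    have "{e\<in>E1. s0 e \<in> S \<and> t0 e \<in> S} = {e\<in>E1. ends Q e \<subseteq> S}" using st0 E1 by auto
    moreover have "int (card {e\<in>E1. ends Q e \<subseteq> S}) \<le> int CARD('d) * int (card S) + - int CARD('d)"
      using t1 S by (simp add: tight_def sparsity_type_def spanning_subgraph_def)
    ultimately show ?thesis by (simp flip: of_nat_mult of_nat_add)
  qed
  \<comment> \<open>A single vertex spans at most \<open>d - d = 0\<close> edges of the first graph.
    These edges will get gain 0, so a loop among them would lift to loops.\<close>
  have nonloop: "s0 e \<noteq> t0 e" if e: "e \<in> E1" for e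
  proof
    assume "s0 e = t0 e"
    then have "e \<in> {f\<in>E1. s0 f \<in> {s0 e} \<and> t0 f \<in> {s0 e}}" using e by auto
    moreover have "card {f\<in>E1. s0 f \<in> {s0 e} \<and> t0 f \<in> {s0 e}} = 0"
      using sparse1[of "{s0 e}"] st0V[OF E1[OF e]] by simp
    ultimately show False using finE1 by auto
  qed
  have "\<exists>v :: 'e \<Rightarrow> real ^ 'd. dual_family s0 t0 v E1"
    using st0V E1 by (intro generic_directions[OF finV finE1 _ sparse1]) auto
  then obtain v :: "'e \<Rightarrow> real ^ 'd" where v: "dual_family s0 t0 v E1" by blast
  then have "\<exists>q. \<forall>e\<in>E1. dir_row s0 t0 v e (q e) = 1 \<and> (\<forall>f\<in>E1-{e}. dir_row s0 t0 v f (q e) = 0)"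
    unfolding dual_family_def by (intro bchoice) auto
  then obtain q where q: "\<And>e. e \<in> E1 \<Longrightarrow> dir_row s0 t0 v e (q e) = 1"
      "\<And>e f. e \<in> E1 \<Longrightarrow> f \<in> E1 \<Longrightarrow> f \<noteq> e \<Longrightarrow> dir_row s0 t0 v f (q e) = 0"
    by blast
  let ?P = "less_pairs :: ('d \<times> 'd) set"
  \<comment> \<open>The positions on and above the diagonal, the future support of
    \<open>L\<close>.\<close>
  define W where "W = ?P \<union> range (\<lambda>k. (k, k))"
  have cardW: "card W = (CARD('d) + 1) choose 2"
  proof -
    have "card W = card ?P + card (range (\<lambda>k :: 'd. (k, k)))"
      unfolding W_def by (rule card_Un_disjoint) auto
    also have "card (range (\<lambda>k :: 'd. (k, k))) = CARD('d)" by (rule card_image) (auto intro: inj_onI)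
    finally show ?thesis by (simp add: card_less_pairs numeral_2_eq_2)
  qed
  obtain f where f: "bij_betw f E2 ((?V \<times> ?P) <+> W)"
    and fends: "\<And>e j p. e \<in> E2 \<Longrightarrow> f e = Inl (j, p) \<Longrightarrow> j \<in> ends Q e"
    using tight_assignment[OF Q _ t2 _ card_less_pairs _ cardW] E by (metis Un_upper2 finite)
  define f' where "f' = inv_into E2 f"
  have f'f: "f' (f e) = e" if "e \<in> E2" for e
    using f that by (simp add: f'_def bij_betw_def)
  have ff': "f (f' x) = x" "f' x \<in> E2" if "x \<in> (?V \<times> ?P) <+> W" for x
    using f that by (auto simp: f'_def bij_betw_def f_inv_into_f inv_into_into)
  \<comment> \<open>Edges are reoriented so that the vertex matched with an edge becomes its target,
    as only the rotation of the target enters the equation.\<close>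
  define t where "t e = (if e \<in> E2 then (case f e of Inl (j, p) \<Rightarrow> j | Inr p \<Rightarrow> t0 e) else t0 e)" for e
  define s where "s e = (if t e = t0 e then s0 e else t0 e)" for e
  \<comment> \<open>With these gains and bars, an edge \<open>Inl (j, k, l)\<close> reads the entry \<open>(l, k)\<close> of \<open>L - A j\<close>,
    and an edge \<open>Inr (k, l)\<close> reads the entry \<open>(k, l)\<close> of \<open>L - A (t e)\<close>.\<close>
  define c :: "'e \<Rightarrow> 'd \<Rightarrow>\<^sub>0 int" where
    "c e = (if e \<in> E2 then (case f e of Inl (j, k, l) \<Rightarrow> frag_of k | Inr (k, l) \<Rightarrow> frag_of l) else 0)" for e
  define w :: "'e \<Rightarrow> real ^ 'd" where
    "w e = (if e \<in> E2 then (case f e of Inl (j, k, l) \<Rightarrow> axis l 1 | Inr (k, l) \<Rightarrow> axis k 1) else v e)" for e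
  have cases2: "(\<exists>j k l. f e = Inl (j, k, l) \<and> j \<in> ?V \<and> (k, l) \<in> ?P) \<or> (\<exists>k l. f e = Inr (k, l) \<and> (k, l) \<in> W)"
    if "e \<in> E2" for e
  proof -
    have "f e \<in> (?V \<times> ?P) <+> W" using f that by (auto simp: bij_betw_def)
    then show ?thesis by auto
  qed
  have ends: "ends Q e = {s e, t e}" if e: "e \<in> ?E" for e
  proof -
    have "t e \<in> ends Q e"
    proof (cases "e \<in> E2")
      case True
      then show ?thesis using cases2[OF True] fends[OF True] st0[OF e] by (auto simp: t_def)
    qed (use st0[OF e] in \<open>simp add: t_def\<close>)
    then show ?thesis using st0[OF e] by (auto simp: s_def)
  qed
  have st: "s e \<in> ?V" "t e \<in> ?V" if "e \<in> ?E" for e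
    using ends[OF that] mg that by (auto simp: is_multigraph_def)
  have on1: "s e = s0 e" "t e = t0 e" "c e = 0" "w e = v e" if "e \<in> E1" for e
    using that E by (auto simp: s_def t_def c_def w_def)
  have loop: "c e \<noteq> 0" if "e \<in> ?E" "s e = t e" for e
  proof (cases "e \<in> E2")
    case True
    then show ?thesis using cases2[OF True] by (auto simp: c_def)
  next
    case False
    then show ?thesis using that E nonloop[of e] on1[of e] by auto
  qed
  obtain iv :: "'v \<times> ('d \<Rightarrow>\<^sub>0 int) \<Rightarrow> 'a" where iv: "inj_on iv (?V \<times> UNIV)"
    using ex_inj_on_cover[OF finV] by blast
  obtain ie :: "'e \<times> ('d \<Rightarrow>\<^sub>0 int) \<Rightarrow> 'b" where ie: "inj_on ie (?E \<times> UNIV)"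
    using ex_inj_on_cover[OF finE] by blast
  interpret gain_graph ?V ?E s t c iv ie
    using finV finE neV iv ie st loop by unfold_locales auto
  have conn: "(\<lambda>x y. \<exists>e\<in>?E. c e = 0 \<and> {s e, t e} = {x, y})\<^sup>*\<^sup>* u u'" if "u \<in> ?V" "u' \<in> ?V" for u u'
  proof -
    have "(\<lambda>x y. \<exists>e\<in>E1. {s e, t e} = {x, y})\<^sup>*\<^sup>* u u'"
      using ends st E1 that by (intro tight_connected[OF t1 _ finV finE1]) auto
    then show ?thesis by (rule rtranclp_mono[THEN predicate2D, rotated]) (use on1(3) E1 in blast)
  qed
  \<comment> \<open>The edges matched with the diagonal symbols carry all basis vectors as
    gains.\<close>
  have gen: "\<exists>e\<in>?E. c e = frag_of k" for k
  proof -
    have k: "Inr (k, k) \<in> (?V \<times> ?P) <+> W" by (auto simp: W_def)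
    show ?thesis using ff'[OF k] E2 by (intro bexI[of _ "f' (Inr (k, k))"]) (auto simp: c_def)
  qed
  have w0: "w e \<noteq> 0" if "e \<in> ?E" for e
  proof (cases "e \<in> E2")
    case True
    then show ?thesis using cases2[OF True] by (auto simp: w_def)
  next
    case False
    then have "e \<in> E1" using that E by blast
    then show ?thesis using q(1)[of e] on1(4)[of e] by (auto simp: dir_row_def)
  qed
  have surj: "\<exists>p A L. (\<forall>u\<in>?V. transpose (A u) = - A u) \<and>
      (\<forall>e\<in>?E. (L *v int_coords (c e) + A (t e) *v (w e - int_coords (c e)) + p (t e) - p (s e)) \<bullet> w e = y e)"
    for y :: "'e \<Rightarrow> real"
  proof -
    \<comment> \<open>The positions are found from the first graph alone, with the dual fields: its
      equations contain neither \<open>A\<close> nor \<open>L\<close>. After that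
      \<open>\<delta>\<close> is a known term.\<close>
    define p where "p u = (\<Sum>e\<in>E1. y e *\<^sub>R q e u)" for u
    define \<delta> where "\<delta> e = p (t e) - p (s e)" for e
    \<comment> \<open>Solves the equation of the edge matched with \<open>(j, k, l)\<close>: the
      entry of \<open>L\<close> at \<open>(l, k)\<close> is below the diagonal, hence 0, and that of
      \<open>A j\<close> is \<open>- B j k l\<close>.\<close>
    define B where "B j k l = y (f' (Inl (j, k, l))) - \<delta> (f' (Inl (j, k, l))) $ l" for j k l
    define A :: "'v \<Rightarrow> real ^ 'd ^ 'd" where
      "A j = (\<chi> a b. if (a, b) \<in> ?P then B j a b else if (b, a) \<in> ?P then - B j b a else 0)" for j
    \<comment> \<open>Once \<open>p\<close> and \<open>A\<close> are known, each equation of a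
      symbol \<open>(k, l)\<close> in \<open>W\<close> determines its own entry of
      \<open>L\<close>.\<close>
    define L :: "real ^ 'd ^ 'd" where
      "L = (\<chi> k l. if (k, l) \<in> W then y (f' (Inr (k, l))) + A (t (f' (Inr (k, l)))) $ k $ l - \<delta> (f' (Inr (k, l))) $ k else 0)"
    have skew: "transpose (A j) = - A j" for j
      by (auto simp: transpose_def A_def vec_eq_iff dest: less_pairs_asym)
    have diag: "A j $ k $ k = 0" for j k by (simp add: A_def)
    have entry: "(L *v axis b 1 + A j *v (axis a 1 - axis b 1) + x) \<bullet> axis a 1 = L $ a $ b - A j $ a $ b + x $ a"
      for j a b x
      by (simp add: inner_add_left matrix_vector_mult_diff_distrib inner_diff_left matrix_axis_entry diag inner_axis)
    have "(L *v int_coords (c e) + A (t e) *v (w e - int_coords (c e)) + p (t e) - p (s e)) \<bullet> w e = y e"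
      if e: "e \<in> ?E" for e
    proof (cases "e \<in> E1")
      case True
      \<comment> \<open>Written as a difference from the zero field so that
        \<open>dir_row_diff_sum\<close> applies.\<close>
      have "dir_row s0 t0 v e p = dir_row s0 t0 v e (\<lambda>u. 0 - (\<Sum>e\<in>E1. (- y e) *\<^sub>R q e u))"
        by (simp add: p_def dir_row_def sum_negf)
      also have "\<dots> = (\<Sum>f\<in>E1. y f * dir_row s0 t0 v e (q f))"
        unfolding dir_row_diff_sum by (simp add: dir_row_def sum_negf)
      also have "\<dots> = (\<Sum>f\<in>E1. if f = e then y e else 0)"
        using q True by (intro sum.cong) auto
      finally have "(p (t0 e) - p (s0 e)) \<bullet> v e = y e"
        using finE1 True by (simp add: dir_row_def inner_commute)
      \<comment> \<open>With gain 0 the attachment point on the target is \<open>v e\<close>,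
        parallel to the bar, so rotating the target does not affect the equation.\<close>
      moreover have "(A (t0 e) *v v e) \<bullet> v e = 0" by (rule skew_inner_self[OF skew])
      ultimately show ?thesis
        using on1[OF True] by (simp add: inner_add_left inner_diff_left)
    next
      case False
      then have eE2: "e \<in> E2" using e E by blast
      consider j k l where "f e = Inl (j, k, l)" "(k, l) \<in> ?P" | k l where "f e = Inr (k, l)" "(k, l) \<in> W"
        using cases2[OF eE2] by blast
      then show ?thesis
      proof cases
        case 1
        have fe: "f' (Inl (j, k, l)) = e" using f'f[OF eE2] 1 by simp
        have te: "t e = j" "c e = frag_of k" "w e = axis l 1" using eE2 1 by (simp_all add: t_def c_def w_def)
        have "(l, k) \<notin> W" using 1(2) by (auto simp: W_def dest: less_pairs_asym)
        then have "L $ l $ k = 0" by (simp add: L_def)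
        moreover have "A j $ l $ k = - B j k l" using 1(2) less_pairs_asym by (auto simp: A_def)
        ultimately show ?thesis
          using entry[of k j l "\<delta> e"] fe by (simp add: te int_vec_indicator add_diff_eq B_def \<delta>_def)
      next
        case 2
        have fe: "f' (Inr (k, l)) = e" using f'f[OF eE2] 2 by simp
        have te: "c e = frag_of l" "w e = axis k 1" using eE2 2 by (simp_all add: c_def w_def)
        have "L $ k $ l = y e + A (t e) $ k $ l - \<delta> e $ k" using 2(2) fe by (simp add: L_def)
        then show ?thesis
          using entry[of l "t e" k "\<delta> e"] by (simp add: te int_vec_indicator add_diff_eq \<delta>_def)
      qed
    qed
    then show ?thesis using skew by blast
  qed
  have iso: "multigraph_iso Q qgraph" using ends by (intro quotient_iso) auto
  have "card (verts qgraph) = card ?V"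
    using iso by (auto simp: multigraph_iso_def dest: bij_betw_same_card)
  then have "rigidity_rank (standard_framework w) standard_reps =
      ((CARD('d) + 1) choose 2) * (card (verts qgraph) - 1) + (CARD('d))\<^sup>2"
    using rigidity_rank_standard[OF surj] m by simp
  then have "infinitesimally_rigid (standard_framework w)"
    unfolding infinitesimally_rigid_def using valid_standard by (intro exI[of _ standard_reps]) simp
  moreover have "periodic_framework (standard_framework w)"
    using conn gen w0 by (rule periodic_framework_standard)
  ultimately show ?thesis using iso by (intro exI[of _ "standard_framework w"]) simp
qed

theorem theorem2:
  fixes d n :: nat and Q :: "('v, 'e) multigraph"
  assumes "d = CARD('d::finite)"
    and "n \<ge> 1"
    and "finite_multigraph Q"
    and "card (verts Q) = n"
    and "card (edges Q) = ((d + 1) choose 2) * (n - 1) + d\<^sup>2"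
  shows "(sparse_decomposition d Q \<longleftrightarrow> sparse_disjoint_subgraphs d Q) \<and>
    ((\<exists>F :: ('a::infinite, 'b::infinite, 'd) framework.
         periodic_framework F \<and> infinitesimally_rigid F \<and>
         multigraph_iso Q (quotient_graph (graph F) (periods F)))
      \<longleftrightarrow> sparse_decomposition d Q)"
proof -
  have n: "card (verts Q) \<ge> 1"
    and m: "card (edges Q) = ((CARD('d) + 1) choose 2) * (card (verts Q) - 1) + (CARD('d))\<^sup>2"
    using assms by simp_all
  show ?thesis
    unfolding assms(1)
    using sparse_decomposition_iff[OF assms(3) n m]
      rigid_framework_imp_decomposition[OF assms(3) n m]
      decomposition_imp_rigid_framework[OF assms(3) n m]
    by blast
qed

end
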